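(* Let $X=(V,E)$ be a vertex-transitive graph that is locally finite, infinite and connected, let $\Gamma$ be a closed subgroup of $\mathrm{Aut}(X)$ acting transitively on $X$, and fix a reference vertex $o\in V$. Let $P$ be an irreducible, space homogeneous (i.e. $\Gamma$-invariant), symmetric Markov operator on $X$ such that $H_P(1)<\infty$. Then the following hold. (1) Suppose $P^{2n}(o,o)\ge\exp(-\gamma(n))$ for all integers $n\ge1$, where $\gamma:[1,\infty)\to(0,\infty)$ is an unbounded function such that both $n\mapsto\gamma(n)$ and $n\mapsto n^{1/2}/\gamma(n)$ are increasing on $[1,\infty)$ and $\lim_{n\to\infty}\gamma(n)/n^{1/2}=0$. Then $(X,P)$ has the Liouville property. (2) Suppose $P^{2n}(o,o)\ge\exp(-\gamma(n))$ for all integers $n\ge1$, where $\gamma:[1,\infty)\to(0,\infty)$ is a strictly increasing unbounded function such that for some $\beta\in(0,\frac12)$ the function $n\mapsto n^{\beta}/\gamma(n)$ is non-decreasing on $[1,\infty)$. Define $$\rho(n)=\inf\left\{x:\ \gamma^{-1}(x/2)/x>n\right\}.$$ Then there is a constant $C=C(\beta)$, depending only on $\beta$, such that $H_P(n)\le C(\rho(n)+1)$ for all integers $n\ge1$.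
   Context: $\mathrm{Aut}(X)$ is the full automorphism group of $X$ with the topology of pointwise convergence. A Markov operator $P$ on $X$ is given by transition probabilities $P(x,y)$, $x,y\in V$; $P^n(x,y)$ are its $n$-step transition probabilities. $P$ is space homogeneous if $P(g\cdot x,g\cdot y)=P(x,y)$ for all $g\in\Gamma$, $x,y\in V$; it is symmetric if $P(x,y)=P(y,x)$ for all $x,y\in V$; it is irreducible if for all $x,y\in V$ there is $n$ with $P^n(x,y)>0$. $H_P(n)=-\sum_{x\in V}P^n(o,x)\log P^n(o,x)$ is the Shannon entropy of the $n$-step transition probability (with $0\log0=0$). $(X,P)$ has the Liouville property if all bounded functions $h:V\to\mathbb{R}$ satisfying $h(x)=\sum_yP(x,y)h(y)$ for all $x\in V$ are constant. In (2), the hypotheses force $\gamma$ to be continuous, so that $\gamma^{-1}:[\gamma(1),\infty)\to[1,\infty)$ is the inverse function, and the infimum is over those $x\ge2\gamma(1)$ satisfying the inequality. *)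

theory Defs
  imports "HOL-Probability.Probability" "HOL-Algebra.Group"
begin

definition graph_auts :: "('v \<Rightarrow> 'v \<Rightarrow> bool) \<Rightarrow> ('v \<Rightarrow> 'v) set" where
  "graph_auts E = {g. bij g \<and> (\<forall>x y. E (g x) (g y) \<longleftrightarrow> E x y)}"

definition Aut_group :: "('v \<Rightarrow> 'v \<Rightarrow> bool) \<Rightarrow> ('v \<Rightarrow> 'v) monoid" where
  "Aut_group E = \<lparr>carrier = graph_auts E, mult = (\<circ>), one = id\<rparr>"

definition Aut_topology :: "('v \<Rightarrow> 'v \<Rightarrow> bool) \<Rightarrow> ('v \<Rightarrow> 'v) topology" where
  "Aut_topology E =
     subtopology (product_topology (\<lambda>_. discrete_topology UNIV) UNIV) (graph_auts E)"

definition acts_transitively :: "('v \<Rightarrow> 'v) set \<Rightarrow> bool" where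
  "acts_transitively G \<longleftrightarrow> (\<forall>x y. \<exists>g\<in>G. g x = y)"

text \<open>The vertex set is the whole type \<^typ>\<open>'v\<close>; graphs are simple and undirected.\<close>

locale infinite_transitive_graph =
  fixes E :: "'v \<Rightarrow> 'v \<Rightarrow> bool"
  assumes edges_sym: "symp E"
    and edges_irrefl: "irreflp E"
    and locally_finite: "\<And>x. finite {y. E x y}"
    and infinite_vertices: "infinite (UNIV :: 'v set)"
    and connected_graph: "\<And>x y. E\<^sup>*\<^sup>* x y"
    and vertex_transitive: "acts_transitively (graph_auts E)"

text \<open>A Markov operator is a kernel \<open>P\<close> with \<open>P(x,y) = pmf (P x) y\<close>. A \<^typ>\<open>'v pmf\<close> has
  countable support, which is no restriction: a connected locally finite graph is countable.\<close>

primrec nstep :: "('v \<Rightarrow> 'v pmf) \<Rightarrow> nat \<Rightarrow> 'v \<Rightarrow> 'v pmf" where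
  "nstep P 0 x = return_pmf x"
| "nstep P (Suc n) x = bind_pmf (P x) (nstep P n)"

text \<open>Valued in \<open>[0,\<infinity>]\<close>; note that \<^term>\<open>0 * ln 0 = (0::real)\<close> holds as required.\<close>

definition entropy_step :: "('v \<Rightarrow> 'v pmf) \<Rightarrow> 'v \<Rightarrow> nat \<Rightarrow> ennreal" where
  "entropy_step P v0 n =
     (\<Sum>\<^sub>\<infinity>x. ennreal (- (pmf (nstep P n v0) x * ln (pmf (nstep P n v0) x))))"

definition liouville :: "('v \<Rightarrow> 'v pmf) \<Rightarrow> bool" where
  "liouville P \<longleftrightarrow>
     (\<forall>h :: 'v \<Rightarrow> real. bounded (range h) \<and> (\<forall>x. h x = (\<Sum>\<^sub>\<infinity>y. pmf (P x) y * h y))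
        \<longrightarrow> (\<exists>c. \<forall>x. h x = c))"

locale homogeneous_walk = infinite_transitive_graph E
  for E :: "'v \<Rightarrow> 'v \<Rightarrow> bool" +
  fixes \<Gamma> :: "('v \<Rightarrow> 'v) set" and v0 :: 'v and P :: "'v \<Rightarrow> 'v pmf"
  assumes subgroup_Aut: "subgroup \<Gamma> (Aut_group E)"
    and closed_Aut: "closedin (Aut_topology E) \<Gamma>"
    and transitive_\<Gamma>: "acts_transitively \<Gamma>"
    and irreducible: "\<And>x y. \<exists>n. pmf (nstep P n x) y > 0"
    and space_homogeneous: "\<And>g x y. g \<in> \<Gamma> \<Longrightarrow> pmf (P (g x)) (g y) = pmf (P x) y"
    and symmetric: "\<And>x y. pmf (P x) y = pmf (P y) x"
    and finite_entropy: "entropy_step P v0 1 < \<infinity>"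

definition return_lower_bound :: "('v \<Rightarrow> 'v pmf) \<Rightarrow> 'v \<Rightarrow> (real \<Rightarrow> real) \<Rightarrow> bool" where
  "return_lower_bound P v0 \<gamma> \<longleftrightarrow>
     (\<forall>n::nat. n \<ge> 1 \<longrightarrow> pmf (nstep P (2 * n) v0) v0 \<ge> exp (- \<gamma> (real n)))"

text \<open>A function \<open>\<gamma> : [1,\<infinity>) \<rightarrow> (0,\<infinity>)\<close> is a total function of which only the values
  on \<open>{1..}\<close> are ever used.\<close>

definition unbounded_positive :: "(real \<Rightarrow> real) \<Rightarrow> bool" where
  "unbounded_positive \<gamma> \<longleftrightarrow> (\<forall>t\<ge>1. \<gamma> t > 0) \<and> \<not> bounded (\<gamma> ` {1..})"

text \<open>Under the hypotheses on \<open>\<gamma>\<close> below, \<open>\<gamma>\<close> is a continuous bijection from \<open>[1,\<infinity>)\<close> onto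
  \<open>[\<gamma>(1),\<infinity>)\<close>, so \<open>inv_into {1..} \<gamma> (x / 2)\<close> is the genuine inverse for \<open>x \<ge> 2 \<gamma>(1)\<close>.\<close>

definition rho :: "(real \<Rightarrow> real) \<Rightarrow> real \<Rightarrow> real" where
  "rho \<gamma> n = Inf {x. x \<ge> 2 * \<gamma> 1 \<and> inv_into {1..} \<gamma> (x / 2) / x > n}"

text \<open>\<open>entropy_const TYPE('v) \<beta> C\<close>: the bound \<open>H\<^sub>P(n) \<le> C (\<rho>(n) + 1)\<close> holds with this \<open>C\<close>
  for all admissible graphs, groups, base points, operators and \<open>\<gamma>\<close> (with exponent \<open>\<beta>\<close>)
  having vertex set \<^typ>\<open>'v\<close>.
  HOL cannot quantify over the type \<^typ>\<open>'v\<close> below an existential, so that \<open>C\<close> depends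
  on \<open>\<beta>\<close> alone, and not on \<^typ>\<open>'v\<close>, is expressed by saying that some \<open>C\<close> works for
  vertex set \<^typ>\<open>nat\<close> and that every \<open>C\<close> which does so works for every \<^typ>\<open>'v\<close>.\<close>

definition entropy_const :: "'v itself \<Rightarrow> real \<Rightarrow> real \<Rightarrow> bool" where
  "entropy_const (_ :: 'v itself) \<beta> C \<longleftrightarrow>
     (\<forall>(E :: 'v \<Rightarrow> 'v \<Rightarrow> bool) \<Gamma> v0 P \<gamma>.
        homogeneous_walk E \<Gamma> v0 P \<and>
        unbounded_positive \<gamma> \<and> strict_mono_on {1..} \<gamma> \<and>
        mono_on {1..} (\<lambda>t. t powr \<beta> / \<gamma> t) \<and>
        return_lower_bound P v0 \<gamma>
        \<longrightarrow> (\<forall>n::nat. n \<ge> 1 \<longrightarrow> entropy_step P v0 n \<le> ennreal (C * (rho \<gamma> (real n) + 1))))"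

end

theory Submission
  imports Defs "HOL-Real_Asymp.Real_Asymp"
begin

text \<open>Both claims come from one statement about where the walk is at time \<open>t\<close>
  (\<open>trapping_set_of_return_bound\<close>): a return probability
  \<open>P\<^sup>2\<^sup>n(o,o) \<ge> exp (- \<gamma>(n))\<close> yields, for every \<open>t\<close>, a set of at most \<open>4 exp (\<gamma>(n))\<close>
  vertices that the walk started at \<open>o\<close> misses at time \<open>t\<close> with probability at most
  \<open>(t + 1) \<gamma>(n) / n\<close>. Indeed \<open>a\<^sub>n = P\<^sup>2\<^sup>n(o,o)\<close> is the squared norm of
  \<open>f = P\<^sup>n(o,\<cdot>)\<close> and is log-convex in \<open>n\<close>, so the fraction of this norm lost in the next
  \<open>s\<close> steps is at most \<open>s \<gamma>(n) / n\<close>. Hence \<open>f\<close> has a small Dirichlet form for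
  \<open>P\<^sup>2\<^sup>s\<close>, and so has its truncation \<open>(f - a\<^sub>n/4)\<^sub>+\<close>, which is supported on at most
  \<open>4 / a\<^sub>n\<close> vertices and keeps half of the squared norm. A walk of \<open>2s\<close> steps started
  from the density proportional to the square of the truncation can leave the support only with
  probability bounded by this Dirichlet form (\<open>exists_trapping_set\<close>), so some starting vertex
  is at least as good, and transitivity moves that vertex to \<open>o\<close>.

  For the Liouville property take \<open>n = t\<^sup>2\<close>: then \<open>\<gamma>(n) = o(t)\<close>, so up to probability
  \<open>o(1)\<close> the walk at time \<open>t\<close> lives on \<open>exp (o(t))\<close> vertices. Finite entropy of one
  step makes the information per step uniformly integrable, so the exceptional event contributes
  only \<open>o(t)\<close> and \<open>H(t) = o(t)\<close> (\<open>entropy_sublinear\<close>). On the other hand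
  \<open>H(t+1) - H(t)\<close> bounds from above the squared Hellinger distance of the law at time \<open>t\<close>
  from a neighbour \<open>y\<close> of \<open>x\<close> to the law at time \<open>t+1\<close> from \<open>x\<close>, up to
  the factor \<open>P(x,y)\<close> (\<open>entropy_increment_ge\<close>). A bounded harmonic \<open>h\<close> with
  \<open>h(x) \<noteq> h(y)\<close> keeps all these distances away from \<open>0\<close> and so forces linear growth of
  the entropy (\<open>liouville_of_sublinear_entropy\<close>).

  For the entropy bound use all scales \<open>n\<^sub>k = 2\<^sup>k m\<close> together. Encoding a vertex by the first
  trapping set that contains it and its position there costs about \<open>\<gamma>(n\<^sub>k)\<close> at scale
  \<open>k\<close>, and a scale beyond \<open>k\<close> is reached with probability at most
  \<open>2 t \<gamma>(n\<^sub>k) / n\<^sub>k\<close>; so \<open>H(t)\<close> is bounded by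
  \<open>\<gamma>(m)\<close> plus a multiple of \<open>t \<Sum>\<^sub>k \<gamma>(n\<^sub>k)\<^sup>2 / n\<^sub>k\<close>, up to lower order terms. Since
  \<open>\<gamma>(2x) \<le> 2\<^sup>\<beta> \<gamma>(x)\<close> with \<open>2\<beta> < 1\<close>, the sum is geometric and dominated by its first
  term, and \<open>H(t) \<le> C (\<gamma>(m) + 1)\<close> as soon as \<open>t \<gamma>(m) \<le> m\<close>
  (\<open>entropy_le_of_polynomial_return_bound\<close>). Any \<open>x\<close> competing in the infimum \<open>\<rho>(t)\<close>
  supplies such an \<open>m\<close> with \<open>\<gamma>(m) \<le> x\<close>. Nothing here depends on the names of the
  vertices, so constants pass from vertex set \<open>nat\<close> to any other countably infinite one
  by relabelling (\<open>entropy_const_relabel\<close>).\<close>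

section \<open>Return probabilities of symmetric kernels\<close>

lemma nstep_add: "nstep P (m + n) x = bind_pmf (nstep P m x) (nstep P n)"
proof (induction m arbitrary: x)
  case 0
  show ?case by (simp add: bind_return_pmf)
next
  case (Suc m)
  show ?case by (simp add: bind_assoc_pmf Suc[abs_def])
qed

lemma nstep_1: "nstep P 1 x = P x"
proof -
  have "nstep P 0 = return_pmf" by (rule ext) simp
  then show ?thesis by (simp add: bind_return_pmf')
qed

lemma ennreal_pmf_bind_count_space:
  "ennreal (pmf (bind_pmf p K) y) = (\<integral>\<^sup>+z. ennreal (pmf p z * pmf (K z) y) \<partial>count_space UNIV)"
  by (simp add: ennreal_pmf_bind nn_integral_measure_pmf ennreal_mult)

lemma nn_integral_count_space_swap:
  fixes f :: "'a \<Rightarrow> 'b \<Rightarrow> ennreal"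
  shows "(\<integral>\<^sup>+x. \<integral>\<^sup>+y. f x y \<partial>count_space UNIV \<partial>count_space UNIV)
       = (\<integral>\<^sup>+y. \<integral>\<^sup>+x. f x y \<partial>count_space UNIV \<partial>count_space UNIV)"
  using nn_integral_fst_count_space[of "case_prod f"] nn_integral_snd_count_space[of "case_prod f"]
  by simp

text \<open>The minimum of \<open>s\<^sup>2 a - 2 s b + c\<close> for \<open>a > 0\<close> is at \<open>s = b / a \<ge> 0\<close>, so nonnegativity on
  the half-line suffices; for \<open>a = 0\<close> large \<open>s\<close> force \<open>b = 0\<close>. This is how the Cauchy--Schwarz
  inequality enters below.\<close>
lemma discriminant_le_of_nonneg:
  fixes a b c :: real
  assumes nonneg: "\<And>s. s \<ge> 0 \<Longrightarrow> 2 * s * b \<le> s\<^sup>2 * a + c" and "a \<ge> 0" "b \<ge> 0" "c \<ge> 0"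
  shows "b\<^sup>2 \<le> a * c"
proof (cases "a = 0")
  case True
  have "b = 0"
  proof (rule ccontr)
    assume "b \<noteq> 0"
    then have "b > 0" using \<open>b \<ge> 0\<close> by simp
    then have "2 * (c + 1) \<le> c"
      using nonneg[of "(c + 1) / b"] True \<open>c \<ge> 0\<close> by simp
    then show False using \<open>c \<ge> 0\<close> by simp
  qed
  then show ?thesis using True by simp
next
  case False
  then have "a > 0" using \<open>a \<ge> 0\<close> by simp
  then show ?thesis
    using nonneg[of "b / a"] \<open>b \<ge> 0\<close> by (simp add: field_simps power2_eq_square)
qed

locale symmetric_kernel =
  fixes P :: "'v \<Rightarrow> 'v pmf"
  assumes kernel_symmetric: "pmf (P x) y = pmf (P y) x"
begin

lemma nstep_symmetric: "pmf (nstep P n x) y = pmf (nstep P n y) x"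
proof (induction n arbitrary: x y)
  case 0
  show ?case by (simp add: indicator_def)
next
  case (Suc n)
  have "ennreal (pmf (nstep P (Suc n) x) y) = (\<integral>\<^sup>+z. ennreal (pmf (P x) z * pmf (nstep P n z) y) \<partial>count_space UNIV)"
    by (simp add: ennreal_pmf_bind_count_space)
  also have "\<dots> = (\<integral>\<^sup>+z. ennreal (pmf (nstep P n y) z * pmf (P z) x) \<partial>count_space UNIV)"
    using Suc.IH[of _ y] kernel_symmetric[of x] by (intro nn_integral_cong) (simp add: mult.commute)
  also have "\<dots> = ennreal (pmf (nstep P (n + 1) y) x)"
    unfolding nstep_add nstep_1[abs_def, of P] ennreal_pmf_bind_count_space
    by (simp add: nstep_1[simplified])
  finally show ?case by simp
qed

lemma chapman_kolmogorov:
  "ennreal (pmf (nstep P (m + n) x) y)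
     = (\<integral>\<^sup>+z. ennreal (pmf (nstep P m x) z * pmf (nstep P n y) z) \<partial>count_space UNIV)"
  by (simp add: nstep_add ennreal_pmf_bind_count_space nstep_symmetric[of n y])

text \<open>By symmetry \<open>P\<^sup>2\<^sup>k(v,v)\<close> is the squared norm of \<open>P\<^sup>k(v,\<cdot>)\<close>, and
  \<open>P\<^sup>2\<^sup>k\<^sup>+\<^sup>2(v,v)\<close> is the inner product of \<open>P\<^sup>k(v,\<cdot>)\<close> with
  \<open>P\<^sup>k\<^sup>+\<^sup>2(v,\<cdot>)\<close>, so the claim is Cauchy--Schwarz.\<close>
lemma return_log_convex:
  "(pmf (nstep P (2 * (k + 1)) v) v)\<^sup>2 \<le> pmf (nstep P (2 * k) v) v * pmf (nstep P (2 * (k + 2)) v) v"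
proof -
  let ?u = "pmf (nstep P k v)" and ?w = "pmf (nstep P (k + 2) v)"
  let ?a = "pmf (nstep P (2 * k) v) v" and ?b = "pmf (nstep P (2 * (k + 1)) v) v"
    and ?c = "pmf (nstep P (2 * (k + 2)) v) v"
  have am_gm: "2 * s * ?b \<le> s\<^sup>2 * ?a + ?c" if "s \<ge> 0" for s :: real
  proof -
    have "ennreal (2 * s * ?b) = ennreal (2 * s) * ennreal (pmf (nstep P (k + (k + 2)) v) v)"
      using that by (simp add: ennreal_mult' algebra_simps flip: mult_2)
    also have "\<dots> = (\<integral>\<^sup>+x. ennreal (2 * s * (?u x * ?w x)) \<partial>count_space UNIV)"
      using that by (subst chapman_kolmogorov) (simp add: ennreal_mult' flip: nn_integral_cmult)
    also have "\<dots> \<le> (\<integral>\<^sup>+x. ennreal (s\<^sup>2 * (?u x * ?u x)) + ennreal (?w x * ?w x) \<partial>count_space UNIV)"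
    proof (intro nn_integral_mono)
      fix x
      have "0 \<le> (s * ?u x - ?w x)\<^sup>2" by simp
      then have "2 * s * (?u x * ?w x) \<le> s\<^sup>2 * (?u x * ?u x) + ?w x * ?w x"
        by (simp add: power2_eq_square algebra_simps)
      then show "ennreal (2 * s * (?u x * ?w x)) \<le> ennreal (s\<^sup>2 * (?u x * ?u x)) + ennreal (?w x * ?w x)"
        by (simp flip: ennreal_plus)
    qed
    also have "\<dots> = ennreal (s\<^sup>2) * ennreal (pmf (nstep P (k + k) v) v)
                   + ennreal (pmf (nstep P ((k + 2) + (k + 2)) v) v)"
      by (subst nn_integral_add) (auto simp only: chapman_kolmogorov ennreal_mult' nn_integral_cmult zero_le_power2
          measurable_count_space borel_measurable_count_space)
    also have "\<dots> = ennreal (s\<^sup>2 * ?a + ?c)"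
    proof -
      have e: "k + k = 2 * k" "k + 2 + (k + 2) = 2 * (k + 2)" by simp_all
      show ?thesis unfolding e by (simp add: ennreal_mult')
    qed
    finally show ?thesis by (subst (asm) ennreal_le_iff) auto
  qed
  show ?thesis by (rule discriminant_le_of_nonneg[OF am_gm]) simp_all
qed

end

text \<open>The ratios \<open>a\<^sub>k\<^sub>+\<^sub>1 / a\<^sub>k\<close> increase, so the one at \<open>n\<close> is at least the geometric mean
  \<open>a\<^sub>n\<^sup>1\<^sup>/\<^sup>n \<ge> exp (- g / n)\<close> of the first \<open>n\<close> of them: what has been lost up to
  time \<open>n\<close> limits what is lost afterwards.\<close>
lemma log_convex_decay:
  fixes a :: "nat \<Rightarrow> real"
  assumes pos: "\<And>k. a k > 0" and conv: "\<And>k. (a (k + 1))\<^sup>2 \<le> a k * a (k + 2)"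
    and "a 0 = 1" and n: "n \<ge> 1" and lower: "a n \<ge> exp (- g)"
  shows "a (n + s) \<ge> a n * (1 - real s * g / n)"
proof -
  define r where "r k = a (Suc k) / a k" for k
  have rpos: "r k > 0" for k by (simp add: r_def pos)
  have "r k \<le> r (Suc k)" for k
    using conv[of k] pos[of k] pos[of "Suc k"] by (simp add: r_def field_simps power2_eq_square)
  then have mono: "k \<le> l \<Longrightarrow> r k \<le> r l" for k l by (rule lift_Suc_mono_le)
  have step: "a (k + s) \<ge> a k * r k ^ s" for k s
  proof (induction s)
    case (Suc s)
    have "a k * r k ^ Suc s = (a k * r k ^ s) * r k" by simp
    also have "\<dots> \<le> a (k + s) * r (k + s)"
      using Suc mono[of k "k + s"] pos[of "k + s"] rpos[of k] by (intro mult_mono) (auto simp: less_imp_le)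
    also have "\<dots> = a (k + Suc s)" using pos[of "k + s"] by (simp add: r_def)
    finally show ?case .
  qed simp
  have up: "j \<le> n \<Longrightarrow> a j \<le> r n ^ j" for j
  proof (induction j)
    case (Suc j)
    have "a (Suc j) = a j * r j" using pos[of j] by (simp add: r_def)
    also have "\<dots> \<le> r n ^ j * r n"
      using Suc mono[of j n] pos[of j] rpos[of j] rpos[of n] by (intro mult_mono) (auto simp: less_imp_le)
    finally show ?case by (simp add: mult.commute)
  qed (simp add: \<open>a 0 = 1\<close>)
  have "exp (- g) \<le> r n ^ n" using up[of n] lower by simp
  then have "ln (exp (- g)) \<le> ln (r n ^ n)" using rpos[of n] by (subst ln_le_cancel_iff) auto
  then have "- g \<le> n * ln (r n)" using rpos[of n] by (simp add: ln_realpow)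
  then have l: "ln (r n) \<ge> - g / n" using n by (simp add: field_simps)
  have "1 - real s * g / n \<le> 1 + real s * ln (r n)"
    using mult_left_mono[OF l, of "real s"] by simp
  also have "\<dots> \<le> exp (real s * ln (r n))" by (rule exp_ge_add_one_self)
  also have "\<dots> = r n ^ s" using rpos[of n] by (simp add: exp_of_nat_mult)
  finally have "a n * (1 - real s * g / n) \<le> a n * r n ^ s" using pos[of n] by simp
  also have "\<dots> \<le> a (n + s)" by (rule step)
  finally show ?thesis .
qed

section \<open>Finite sets that trap a symmetric walk\<close>

lemma superlevel_set_pmf:
  assumes "c > 0"
  shows "finite {x. pmf p x > c}" "card {x. pmf p x > c} \<le> 1 / c"
proof -
  have bound: "card F \<le> 1 / c" if "finite F" "F \<subseteq> {x. pmf p x > c}" for F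
  proof -
    have "card F * c = (\<Sum>x\<in>F. c)" by simp
    also have "\<dots> \<le> sum (pmf p) F" using that by (intro sum_mono) auto
    also have "\<dots> = measure (measure_pmf p) F" using that by (simp add: measure_measure_pmf_finite)
    also have "\<dots> \<le> 1" by simp
    finally show ?thesis using assms by (simp add: field_simps)
  qed
  show "finite {x. pmf p x > c}"
  proof (rule finite_if_finite_subsets_card_bdd[THEN conjunct1])
    show "card F \<le> nat \<lfloor>1 / c\<rfloor>" if "F \<subseteq> {x. pmf p x > c}" "finite F" for F
      using bound[OF that(2,1)] by (simp add: le_nat_floor)
  qed
  then show "card {x. pmf p x > c} \<le> 1 / c" by (rule bound) simp
qed

context symmetric_kernel
begin

text \<open>For \<open>f = P\<^sup>n(v,\<cdot>)\<close> the Dirichlet form of \<open>f\<close> with respect to \<open>P\<^sup>2\<^sup>s\<close> is the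
  right-hand side \<open>a - P\<^sup>2\<^sup>(\<^sup>n\<^sup>+\<^sup>s\<^sup>)(v,v)\<close>. With \<open>A\<close> the set where \<open>f\<close> exceeds
  \<open>a/4\<close> and \<open>g = (f - a/4)\<^sup>2\<close> on \<open>A\<close>, each jump out of \<open>A\<close> costs at least
  \<open>g\<close> at its starting point, so the Dirichlet form bounds the \<open>g\<close>-weighted sum of the
  escape probabilities; as \<open>g\<close> has total mass at least \<open>a/2\<close>, some vertex escapes with
  probability at most the quotient.\<close>
lemma exists_trapping_set:
  fixes n s :: nat and v :: 'v
  defines "a \<equiv> pmf (nstep P (2 * n) v) v"
  assumes "a > 0"
  shows "\<exists>z A. finite A \<and> real (card A) \<le> 4 / a \<and>
           a / 2 * measure (nstep P (2 * s) z) (- A) \<le> a - pmf (nstep P (2 * (n + s)) v) v"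
proof -
  define b where "b = pmf (nstep P (2 * (n + s)) v) v"
  define f where "f = pmf (nstep P n v)"
  define A where "A = {x. f x > a / 4}"
  define g where "g x = (if x \<in> A then (f x - a / 4)\<^sup>2 else 0)" for x
  define K where "K = (\<lambda>x. pmf (nstep P (2 * s) x))"
  define out :: "'v \<Rightarrow> real" where "out = indicator (- A)"
  define escape where "escape x = measure (nstep P (2 * s) x) (- A)" for x
  have finA: "finite A" and cardA: "card A \<le> 4 / a"
    using superlevel_set_pmf[of "a / 4" "nstep P n v"] \<open>a > 0\<close> by (auto simp: A_def f_def)
  have f0 [simp]: "f x \<ge> 0" and g0 [simp]: "g x \<ge> 0" and K0 [simp]: "K x y \<ge> 0"
    and out0 [simp]: "out x \<ge> 0" for x y
    by (auto simp: f_def g_def K_def out_def)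
  have Ksym: "K x y = K y x" for x y
    unfolding K_def by (rule nstep_symmetric)
  have Ksum: "(\<integral>\<^sup>+y. ennreal (K x y) \<partial>count_space UNIV) = 1" for x
    by (simp add: K_def nn_integral_pmf)
  have norm_f: "(\<integral>\<^sup>+x. ennreal (f x * f x) \<partial>count_space UNIV) = ennreal a"
    using chapman_kolmogorov[of n n v v] by (simp add: f_def a_def mult_2)
  have integral_g: "(\<integral>\<^sup>+x. ennreal (g x * h x) \<partial>count_space UNIV) = ennreal (\<Sum>x\<in>A. g x * h x)"
    if "\<And>x. h x \<ge> 0" for h
    using finA that
    by (subst nn_integral_count_space'[of A]) (auto simp: g_def intro!: sum_ennreal)
  \<comment> \<open>the level \<open>a/4\<close> costs at most \<open>2 * (a/4)\<close> of the squared norm \<open>a\<close>,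
    because \<open>f\<close> has total mass 1\<close>
  have mass: "a / 2 \<le> sum g A"
  proof -
    have "ennreal a \<le> (\<integral>\<^sup>+x. ennreal (g x * 1) + ennreal (a / 2) * ennreal (f x) \<partial>count_space UNIV)"
      unfolding norm_f[symmetric]
    proof (intro nn_integral_mono)
      fix x
      have "f x * f x \<le> g x + a / 2 * f x"
      proof (cases "x \<in> A")
        case True
        then show ?thesis by (simp add: g_def power2_eq_square algebra_simps)
      next
        case False
        then have "f x * f x \<le> a / 4 * f x" by (intro mult_right_mono) (auto simp: A_def)
        also have "\<dots> \<le> a / 2 * f x" using \<open>a > 0\<close> by (intro mult_right_mono) auto
        finally show ?thesis using g0[of x] by linarith
      qed
      then show "ennreal (f x * f x) \<le> ennreal (g x * 1) + ennreal (a / 2) * ennreal (f x)"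
        using \<open>a > 0\<close> by (simp flip: ennreal_plus ennreal_mult)
    qed
    also have "\<dots> = ennreal (sum g A) + ennreal (a / 2)"
    proof -
      have "(\<integral>\<^sup>+x. ennreal (f x) \<partial>count_space UNIV) = 1" by (simp add: f_def nn_integral_pmf)
      then show ?thesis
        using integral_g[of "\<lambda>_. 1"] by (simp add: nn_integral_add nn_integral_cmult)
    qed
    also have "\<dots> = ennreal (sum g A + a / 2)"
      using \<open>a > 0\<close> by (simp add: sum_nonneg flip: ennreal_plus)
    finally have "a \<le> sum g A + a / 2"
      using \<open>a > 0\<close> by (subst (asm) ennreal_le_iff) (auto intro!: add_nonneg_nonneg sum_nonneg)
    then show ?thesis by simp
  qed
  have energy: "(\<Sum>x\<in>A. g x * escape x) \<le> a - b"
  proof -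
    define E where "E h = (\<integral>\<^sup>+x. \<integral>\<^sup>+y. ennreal (h x y * K x y) \<partial>count_space UNIV \<partial>count_space UNIV)"
      for h :: "'v \<Rightarrow> 'v \<Rightarrow> real"
    have E_swap: "E (\<lambda>x y. h y x) = E h" for h
      unfolding E_def by (subst nn_integral_count_space_swap) (simp add: Ksym)
    have E_add: "E (\<lambda>x y. h x y + k x y) = E h + E k"
      if "\<And>x y. h x y \<ge> 0" "\<And>x y. k x y \<ge> 0" for h k
      unfolding E_def using that by (simp add: distrib_right ennreal_plus nn_integral_add)
    have E_fst: "E (\<lambda>x y. f x * f x) = ennreal a"
      unfolding E_def norm_f[symmetric]
      by (simp add: ennreal_mult' nn_integral_cmult Ksum mult.assoc)
    have E_out: "E (\<lambda>x y. g x * out y) = ennreal (\<Sum>x\<in>A. g x * escape x)"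
    proof -
      have "(\<integral>\<^sup>+y. ennreal (out y * K x y) \<partial>count_space UNIV) = ennreal (escape x)" for x
      proof -
        have "ennreal (escape x) = (\<integral>\<^sup>+y. indicator (- A) y \<partial>nstep P (2 * s) x)"
          by (simp add: escape_def measure_pmf.emeasure_eq_measure)
        also have "\<dots> = (\<integral>\<^sup>+y. ennreal (out y * K x y) \<partial>count_space UNIV)"
          unfolding nn_integral_measure_pmf
          by (intro nn_integral_cong) (auto simp: out_def K_def indicator_def)
        finally show ?thesis ..
      qed
      then have "E (\<lambda>x y. g x * out y) = (\<integral>\<^sup>+x. ennreal (g x * escape x) \<partial>count_space UNIV)"
        unfolding E_def by (simp add: mult.assoc ennreal_mult' nn_integral_cmult)
      also have "\<dots> = ennreal (\<Sum>x\<in>A. g x * escape x)"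
        by (rule integral_g) (simp add: escape_def)
      finally show ?thesis .
    qed
    have E_prod: "E (\<lambda>x y. f x * f y) = ennreal b"
    proof -
      have "(\<integral>\<^sup>+y. ennreal (f y * K x y) \<partial>count_space UNIV) = ennreal (pmf (nstep P (n + 2 * s) v) x)" for x
        unfolding f_def K_def by (rule chapman_kolmogorov[symmetric])
      then have "E (\<lambda>x y. f x * f y)
          = (\<integral>\<^sup>+x. ennreal (f x * pmf (nstep P (n + 2 * s) v) x) \<partial>count_space UNIV)"
        unfolding E_def by (simp add: mult.assoc ennreal_mult' nn_integral_cmult)
      also have "\<dots> = ennreal b"
        using chapman_kolmogorov[of n "n + 2 * s" v v] by (simp add: f_def b_def algebra_simps)
      finally show ?thesis .
    qed
    \<comment> \<open>the terms in \<open>f\<close> differ by \<open>(f x - f y)\<^sup>2\<close>, which sums to twice the Dirichlet form\<close>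
    have pointwise: "(g x * out y + g y * out x) + (f x * f y + f x * f y) \<le> f x * f x + f y * f y" for x y
    proof -
      have gap: "g x + 2 * (f x * f y) \<le> f x * f x + f y * f y" if "x \<in> A" "y \<notin> A" for x y
      proof -
        have "g x \<le> (f x - f y)\<^sup>2"
          unfolding g_def using that by (auto simp: A_def intro!: power_mono)
        then show ?thesis by (simp add: power2_eq_square algebra_simps)
      qed
      have "2 * (f x * f y) \<le> f x * f x + f y * f y"
        using sum_squares_bound[of "f x" "f y"] by (simp add: power2_eq_square)
      then show ?thesis
        using gap[of x y] gap[of y x] by (auto simp: out_def g_def algebra_simps)
    qed
    have "E (\<lambda>x y. (g x * out y + g y * out x) + (f x * f y + f x * f y)) \<le> E (\<lambda>x y. f x * f x + f y * f y)"
      unfolding E_def using pointwise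
      by (intro nn_integral_mono ennreal_leI mult_right_mono) auto
    also have "E (\<lambda>x y. f x * f x + f y * f y) = ennreal a + ennreal a"
      using E_swap[of "\<lambda>x y. f x * f x"] by (simp add: E_add E_fst)
    also have "E (\<lambda>x y. (g x * out y + g y * out x) + (f x * f y + f x * f y))
        = (ennreal (\<Sum>x\<in>A. g x * escape x) + ennreal (\<Sum>x\<in>A. g x * escape x)) + (ennreal b + ennreal b)"
    proof -
      have nn: "0 \<le> g x * out y" "0 \<le> f x * f y" for x y by simp_all
      show ?thesis
        unfolding E_add[OF add_nonneg_nonneg[OF nn(1) nn(1)] add_nonneg_nonneg[OF nn(2) nn(2)]]
          E_add[OF nn(1) nn(1)] E_add[OF nn(2) nn(2)] E_swap[of "\<lambda>x y. g x * out y"] E_out E_prod ..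
    qed
    finally have "ennreal (((\<Sum>x\<in>A. g x * escape x) + (\<Sum>x\<in>A. g x * escape x)) + (b + b)) \<le> ennreal (a + a)"
      using \<open>a > 0\<close> by (simp add: sum_nonneg escape_def b_def flip: ennreal_plus)
    then show ?thesis using \<open>a > 0\<close> by (subst (asm) ennreal_le_iff) auto
  qed
  obtain z where "a / 2 * escape z \<le> a - b"
  proof (rule ccontr)
    assume "\<not> thesis"
    then have big: "a - b < a / 2 * escape z" for z
      using that[of z] by (meson not_le)
    have "sum g A > 0" using mass \<open>a > 0\<close> by linarith
    then obtain z0 where "z0 \<in> A" "g z0 > 0" by (metis not_less sum_nonpos)
    have "(a - b) * sum g A < (\<Sum>x\<in>A. g x * (a / 2 * escape x))"
      unfolding sum_distrib_left
    proof (rule sum_strict_mono_ex1[OF finA])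
      show "\<forall>x\<in>A. (a - b) * g x \<le> g x * (a / 2 * escape x)"
        using mult_left_mono[OF less_imp_le[OF big] g0] by (metis mult.commute)
      show "\<exists>x\<in>A. (a - b) * g x < g x * (a / 2 * escape x)"
        using mult_strict_left_mono[OF big \<open>g z0 > 0\<close>, of z0] \<open>z0 \<in> A\<close>
        by (metis mult.commute)
    qed
    also have "\<dots> = a / 2 * (\<Sum>x\<in>A. g x * escape x)" by (simp add: sum_distrib_left algebra_simps)
    also have "\<dots> \<le> a / 2 * (a - b)" using energy \<open>a > 0\<close> by (intro mult_left_mono) auto
    finally have "(a - b) * sum g A < (a - b) * (a / 2)" by (simp add: mult.commute)
    moreover have "0 \<le> a - b"
      using energy sum_nonneg[of A "\<lambda>x. g x * escape x"] by (simp add: escape_def)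
    ultimately show False using mult_left_mono[OF mass, of "a - b"] by linarith
  qed
  then show ?thesis using finA cardA unfolding escape_def b_def by blast
qed

end

section \<open>Entropy of probability mass functions\<close>

lemma infsum_ennreal_eq_nn_integral:
  fixes f :: "'a \<Rightarrow> ennreal"
  assumes "countable (UNIV :: 'a set)"
  shows "infsum f UNIV = (\<integral>\<^sup>+x. f x \<partial>count_space UNIV)"
proof -
  have sum_eq: "(\<integral>\<^sup>+x. f x * indicator F x \<partial>count_space UNIV) = sum f F" if "finite F" for F :: "'a set"
    using that by (subst nn_integral_count_space'[of F]) (auto simp: indicator_def)
  define F where "F n = {x :: 'a. to_nat_on UNIV x < n}" for n
  have fin: "finite (F n)" for n
    unfolding F_def using finite_vimage_IntI[OF finite_lessThan inj_on_to_nat_on[OF assms], of n]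
    by (simp add: vimage_def lessThan_def)
  have "(\<integral>\<^sup>+x. f x \<partial>count_space UNIV) = (\<integral>\<^sup>+x. (SUP n. f x * indicator (F n) x) \<partial>count_space UNIV)"
  proof (intro nn_integral_cong antisym)
    fix x
    have "f x = f x * indicator (F (Suc (to_nat_on UNIV x))) x" by (simp add: F_def)
    then show "f x \<le> (SUP n. f x * indicator (F n) x)" by (metis SUP_upper UNIV_I)
    show "(SUP n. f x * indicator (F n) x) \<le> f x"
      by (intro SUP_least) (auto simp: indicator_def)
  qed
  also have "\<dots> = (SUP n. sum f (F n))"
  proof (subst nn_integral_monotone_convergence_SUP)
    show "incseq (\<lambda>n x. f x * indicator (F n) x)"
      by (auto simp: incseq_def le_fun_def F_def indicator_def)
  qed (simp_all add: sum_eq fin)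
  also have "\<dots> \<le> (SUP F\<in>{F. finite F \<and> F \<subseteq> UNIV}. sum f F)"
    using fin by (intro SUP_mono) blast
  finally have "(\<integral>\<^sup>+x. f x \<partial>count_space UNIV) \<le> (SUP F\<in>{F. finite F \<and> F \<subseteq> UNIV}. sum f F)" .
  moreover have "(SUP F\<in>{F. finite F \<and> F \<subseteq> UNIV}. sum f F) \<le> (\<integral>\<^sup>+x. f x \<partial>count_space UNIV)"
    by (intro SUP_least) (auto simp: indicator_def simp flip: sum_eq intro!: nn_integral_mono)
  moreover have "infsum f UNIV = (SUP F\<in>{F. finite F \<and> F \<subseteq> UNIV}. sum f F)"
    by (rule nonneg_infsum_complete) simp
  ultimately show ?thesis by (simp add: antisym)
qed

lemma ennreal_add_le: "ennreal (a + b) \<le> ennreal a + ennreal b"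
proof (cases "a \<ge> 0 \<and> b \<ge> 0")
  case True
  then show ?thesis by simp
next
  case False
  then consider "a \<le> 0" | "b \<le> 0" by linarith
  then show ?thesis
    by cases (auto simp: ennreal_neg intro!: ennreal_leI)
qed

text \<open>For \<open>M = 0\<close> this is the Shannon entropy. For \<open>M > 0\<close> it measures how much of the
  information \<open>- ln p(x)\<close> lies above the level \<open>M\<close>: the embedding into the extended
  nonnegative reals sends negative values to \<open>0\<close>, so the integrand is a positive part.\<close>
definition entropy_excess :: "'a pmf \<Rightarrow> real \<Rightarrow> ennreal" where
  "entropy_excess p M = (\<integral>\<^sup>+x. ennreal (- ln (pmf p x) - M) \<partial>p)"

abbreviation entropy_pmf :: "'a pmf \<Rightarrow> ennreal" where
  "entropy_pmf p \<equiv> entropy_excess p 0"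

lemma entropy_pmf_count_space:
  "entropy_pmf p = (\<integral>\<^sup>+x. ennreal (- (pmf p x * ln (pmf p x))) \<partial>count_space UNIV)"
proof -
  have "ennreal (pmf p x) * ennreal (- ln (pmf p x)) = ennreal (- (pmf p x * ln (pmf p x)))" for x
    by (simp flip: ennreal_mult')
  then show ?thesis by (simp add: entropy_excess_def nn_integral_measure_pmf)
qed

text \<open>Pointwise \<open>p(y) K(y,x) \<le> (p K)(x)\<close>, so information is subadditive along a two-step path, and
  so is the positive part. The case \<open>a = b = 0\<close> is subadditivity of entropy; for positive
  levels the inequality carries uniform integrability from one step to many.\<close>
lemma entropy_excess_bind_le:
  "entropy_excess (bind_pmf p K) (a + b) \<le> entropy_excess p a + (\<integral>\<^sup>+y. entropy_excess (K y) b \<partial>p)"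
proof -
  let ?q = "bind_pmf p K"
  have "entropy_excess ?q (a + b) = (\<integral>\<^sup>+y. \<integral>\<^sup>+x. ennreal (- ln (pmf ?q x) - (a + b)) \<partial>K y \<partial>p)"
    by (simp add: entropy_excess_def)
  also have "\<dots> \<le> (\<integral>\<^sup>+y. \<integral>\<^sup>+x. ennreal (- ln (pmf p y) - a) + ennreal (- ln (pmf (K y) x) - b) \<partial>K y \<partial>p)"
  proof (intro nn_integral_mono_AE, clarsimp simp: AE_measure_pmf_iff, intro nn_integral_mono_AE,
      clarsimp simp: AE_measure_pmf_iff)
    fix y x assume y: "y \<in> set_pmf p" and x: "x \<in> set_pmf (K y)"
    then have pos: "pmf p y > 0" "pmf (K y) x > 0" by (simp_all add: pmf_positive)
    have "ennreal (pmf p y * pmf (K y) x) \<le> ennreal (pmf ?q x)"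
    proof -
      have "ennreal (pmf p y * pmf (K y) x)
          = (\<integral>\<^sup>+z. ennreal (pmf p z * pmf (K z) x) * indicator {y} z \<partial>count_space UNIV)"
        by (subst nn_integral_count_space'[of "{y}"]) auto
      also have "\<dots> \<le> ennreal (pmf ?q x)"
        unfolding ennreal_pmf_bind_count_space
        by (intro nn_integral_mono) (auto simp: indicator_def)
      finally show ?thesis .
    qed
    then have "pmf p y * pmf (K y) x \<le> pmf ?q x" by simp
    then have "ln (pmf p y * pmf (K y) x) \<le> ln (pmf ?q x)"
      using pos by (subst ln_le_cancel_iff) (auto intro: less_le_trans[OF mult_pos_pos])
    then have le: "- ln (pmf ?q x) - (a + b) \<le> (- ln (pmf p y) - a) + (- ln (pmf (K y) x) - b)"
      using pos by (simp add: ln_mult)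
    show "ennreal (- ln (pmf ?q x) - (a + b)) \<le> ennreal (- ln (pmf p y) - a) + ennreal (- ln (pmf (K y) x) - b)"
      using ennreal_leI[OF le] ennreal_add_le by (rule order_trans)
  qed
  also have "\<dots> = entropy_excess p a + (\<integral>\<^sup>+y. entropy_excess (K y) b \<partial>p)"
    by (simp add: nn_integral_add entropy_excess_def measure_pmf.emeasure_space_1)
  finally show ?thesis .
qed

lemma entropy_excess_tendsto_0:
  assumes "entropy_pmf p < \<infinity>"
  shows "(\<lambda>m::nat. entropy_excess p m) \<longlonglongrightarrow> 0"
proof -
  have "(\<lambda>m::nat. entropy_excess p m) \<longlonglongrightarrow> (\<integral>\<^sup>+x. 0 \<partial>p)"
    unfolding entropy_excess_def
  proof (rule nn_integral_dominated_convergence[where w = "\<lambda>x. ennreal (- ln (pmf p x) - 0)"])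
    show "(\<integral>\<^sup>+x. ennreal (- ln (pmf p x) - 0) \<partial>p) < \<infinity>" using assms by (simp add: entropy_excess_def)
    show "AE x in p. (\<lambda>m::nat. ennreal (- ln (pmf p x) - real m)) \<longlonglongrightarrow> 0"
    proof (intro AE_I2)
      fix x
      have "\<forall>\<^sub>F m::nat in sequentially. ennreal (- ln (pmf p x) - real m) = 0"
        using eventually_ge_at_top[of "nat \<lceil>- ln (pmf p x)\<rceil>"]
        by eventually_elim (simp add: ennreal_neg)
      then show "(\<lambda>m::nat. ennreal (- ln (pmf p x) - real m)) \<longlonglongrightarrow> 0"
        by (rule tendsto_eventually)
    qed
  qed (auto intro!: ennreal_leI)
  then show ?thesis by simp
qed

text \<open>\<open>ln r \<le> r - 1\<close> applied to \<open>r = sqrt (v / u)\<close> instead of \<open>v / u\<close>: this keeps the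
  square \<open>(sqrt u - sqrt v)\<^sup>2\<close>, so the Kullback--Leibler divergence dominates the squared
  Hellinger distance.\<close>
lemma gibbs_pointwise:
  fixes u v :: real
  assumes "0 \<le> u" "u > 0 \<Longrightarrow> v > 0" "0 \<le> v"
  shows "- (u * ln u) + u + (sqrt u - sqrt v)\<^sup>2 \<le> - (u * ln v) + v"
proof (cases "u = 0")
  case False
  then have pos: "u > 0" "v > 0" using assms by auto
  have "ln (sqrt v / sqrt u) \<le> sqrt v / sqrt u - 1" using pos by (intro ln_le_minus_one) simp
  then have "2 * u * ln (sqrt v / sqrt u) \<le> 2 * u * (sqrt v / sqrt u - 1)"
    using pos by (intro mult_left_mono) auto
  moreover have "2 * u * (sqrt v / sqrt u) = 2 * (sqrt u * sqrt v)"
    using pos real_sqrt_mult_self[of u] by (simp add: field_simps)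
  moreover have "2 * u * ln (sqrt v / sqrt u) = u * ln v - u * ln u"
    using pos by (simp add: ln_div ln_sqrt algebra_simps)
  ultimately have "u * ln v - u * ln u \<le> 2 * (sqrt u * sqrt v) - 2 * u"
    by (simp add: algebra_simps)
  moreover have "(sqrt u - sqrt v)\<^sup>2 = u + v - 2 * (sqrt u * sqrt v)"
    using pos by (simp add: power2_diff)
  ultimately show ?thesis by linarith
qed (use assms in simp)

lemma gibbs_inequality:
  fixes u v :: real
  assumes "0 \<le> u" "u > 0 \<Longrightarrow> v > 0" "0 \<le> v"
  shows "- (u * ln u) \<le> - (u * ln v) + v"
  using gibbs_pointwise[OF assms] zero_le_power2[of "sqrt u - sqrt v"] \<open>0 \<le> u\<close> by linarith

text \<open>The additive \<open>1\<close> bounds the total mass of \<open>q\<close>, the price for summing the pointwise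
  inequality without subtracting in the extended nonnegative reals.\<close>
lemma entropy_pmf_le_cross_entropy:
  fixes q :: "'a \<Rightarrow> real"
  assumes "\<And>x. q x \<ge> 0" "\<And>x. x \<in> set_pmf p \<Longrightarrow> q x > 0"
    and "(\<integral>\<^sup>+x. ennreal (q x) \<partial>count_space UNIV) \<le> 1"
  shows "entropy_pmf p \<le> (\<integral>\<^sup>+x. ennreal (- ln (q x)) \<partial>p) + 1"
proof -
  have "entropy_pmf p \<le> (\<integral>\<^sup>+x. ennreal (pmf p x) * ennreal (- ln (q x)) + ennreal (q x) \<partial>count_space UNIV)"
    unfolding entropy_pmf_count_space
  proof (intro nn_integral_mono)
    fix x
    have "- (pmf p x * ln (pmf p x)) \<le> - (pmf p x * ln (q x)) + q x"
      using assms(1,2)[of x] by (intro gibbs_inequality) (auto simp: pmf_positive_iff)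
    then have "ennreal (- (pmf p x * ln (pmf p x))) \<le> ennreal (- (pmf p x * ln (q x)) + q x)"
      by (rule ennreal_leI)
    also have "\<dots> \<le> ennreal (- (pmf p x * ln (q x))) + ennreal (q x)"
      by (rule ennreal_add_le)
    finally show "ennreal (- (pmf p x * ln (pmf p x))) \<le> ennreal (pmf p x) * ennreal (- ln (q x)) + ennreal (q x)"
      by (simp flip: ennreal_mult')
  qed
  also have "\<dots> \<le> (\<integral>\<^sup>+x. ennreal (- ln (q x)) \<partial>p) + 1"
    using assms(3) by (simp add: nn_integral_add nn_integral_measure_pmf)
  finally show ?thesis .
qed

text \<open>The squared Hellinger distance, without the customary factor \<open>1/2\<close>.\<close>
definition hellinger :: "'a pmf \<Rightarrow> 'a pmf \<Rightarrow> ennreal" where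
  "hellinger p q = (\<integral>\<^sup>+x. ennreal ((sqrt (pmf p x) - sqrt (pmf q x))\<^sup>2) \<partial>count_space UNIV)"

lemma hellinger_commute: "hellinger p q = hellinger q p"
  by (simp add: hellinger_def power2_commute)

lemma neg_mult_ln_nonneg:
  fixes u v :: real
  assumes "0 \<le> u" "0 \<le> v" "v \<le> 1"
  shows "0 \<le> - (u * ln v)"
  using assms by (cases "v = 0") (auto intro!: mult_nonneg_nonpos)

text \<open>The entropy of a mixture exceeds the mean entropy of its components by the mean divergence of
  the components from the mixture, and each divergence dominates a squared Hellinger distance.\<close>
lemma entropy_bind_ge:
  fixes p :: "'a pmf" and K :: "'a \<Rightarrow> 'b pmf"
  shows "(\<integral>\<^sup>+y. entropy_pmf (K y)
        + hellinger (K y) (bind_pmf p K) \<partial>p) \<le> entropy_pmf (bind_pmf p K)"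
  (is "(\<integral>\<^sup>+y. _ + ?hell y \<partial>measure_pmf p) \<le> entropy_pmf ?q")
proof -
  have "entropy_pmf (K y) + ?hell y + 1 \<le> (\<integral>\<^sup>+x. ennreal (- ln (pmf ?q x)) \<partial>K y) + 1"
    if y: "y \<in> set_pmf p" for y
  proof -
    have "entropy_pmf (K y) + ?hell y + 1
      = (\<integral>\<^sup>+x. ennreal (- (pmf (K y) x * ln (pmf (K y) x)))
            + ennreal ((sqrt (pmf (K y) x) - sqrt (pmf ?q x))\<^sup>2) + ennreal (pmf (K y) x) \<partial>count_space UNIV)"
      by (simp add: nn_integral_add nn_integral_pmf entropy_pmf_count_space hellinger_def)
    also have "\<dots> \<le> (\<integral>\<^sup>+x. ennreal (- (pmf (K y) x * ln (pmf ?q x))) + ennreal (pmf ?q x) \<partial>count_space UNIV)"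
    proof (intro nn_integral_mono)
      fix x
      let ?u = "pmf (K y) x" and ?v = "pmf ?q x"
      have "?v > 0" if "?u > 0"
        using that y by (auto simp: pmf_positive_iff set_bind_pmf)
      then have le: "- (?u * ln ?u) + ?u + (sqrt ?u - sqrt ?v)\<^sup>2 \<le> - (?u * ln ?v) + ?v"
        by (intro gibbs_pointwise) auto
      have nn: "0 \<le> - (?u * ln ?u)" "0 \<le> - (?u * ln ?v)"
        by (rule neg_mult_ln_nonneg; simp add: pmf_le_1)+
      show "ennreal (- (?u * ln ?u)) + ennreal ((sqrt ?u - sqrt ?v)\<^sup>2) + ennreal ?u
          \<le> ennreal (- (?u * ln ?v)) + ennreal ?v"
      proof -
        have "ennreal a + ennreal b + ennreal c \<le> ennreal d + ennreal e"
          if "0 \<le> a" "0 \<le> b" "0 \<le> c" "0 \<le> d" "0 \<le> e" "a + c + b \<le> d + e" for a b c d e :: real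
          using that by (simp add: add_ac flip: ennreal_plus)
        from this[OF nn(1) zero_le_power2 pmf_nonneg nn(2) pmf_nonneg le] show ?thesis .
      qed
    qed
    also have "\<dots> = (\<integral>\<^sup>+x. ennreal (- ln (pmf ?q x)) \<partial>K y) + 1"
      by (simp add: nn_integral_add nn_integral_pmf nn_integral_measure_pmf flip: ennreal_mult')
    finally show ?thesis .
  qed
  then have "(\<integral>\<^sup>+y. entropy_pmf (K y) + ?hell y + 1 \<partial>p)
      \<le> (\<integral>\<^sup>+y. (\<integral>\<^sup>+x. ennreal (- ln (pmf ?q x)) \<partial>K y) + 1 \<partial>p)"
    by (intro nn_integral_mono_AE) (simp add: AE_measure_pmf_iff)
  also have "\<dots> = entropy_pmf ?q + 1"
    by (simp add: nn_integral_add entropy_excess_def)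
  finally have "(\<integral>\<^sup>+y. entropy_pmf (K y) + ?hell y \<partial>p) + 1 \<le> entropy_pmf ?q + 1"
    by (simp add: nn_integral_add)
  then show ?thesis by (simp add: add.commute[of _ 1] ennreal_add_left_cancel_le)
qed

lemma entropy_excess_map_inj: "inj g \<Longrightarrow> entropy_excess (map_pmf g p) M = entropy_excess p M"
  by (simp add: entropy_excess_def pmf_map_inj')

section \<open>Homogeneous walks\<close>

lemma exists_measure_le_of_bind:
  assumes "emeasure (bind_pmf p K) B \<le> ennreal \<delta>" "\<delta> \<ge> 0"
  shows "\<exists>y. measure (K y) B \<le> \<delta>"
proof (rule ccontr)
  assume "\<nexists>y. measure (K y) B \<le> \<delta>"
  then have gt: "measure (K y) B > \<delta>" for y by (simp add: not_le)
  have int: "integrable p (\<lambda>y. measure (K y) B)"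
    by (rule measure_pmf.integrable_const_bound[where B = 1]) auto
  have "ennreal (measure_pmf.expectation p (\<lambda>y. measure (K y) B)) = emeasure (bind_pmf p K) B"
    using nn_integral_eq_integral[OF int] unfolding emeasure_bind_pmf
    by (simp add: measure_pmf.emeasure_eq_measure[symmetric])
  with assms have "measure_pmf.expectation p (\<lambda>y. measure (K y) B) \<le> \<delta>"
    by (metis ennreal_le_iff)
  moreover have "measure_pmf.expectation p (\<lambda>y. measure (K y) B) > \<delta>"
    using int gt by (intro measure_pmf.expectation_greater) auto
  ultimately show False by simp
qed

context homogeneous_walk
begin

sublocale symmetric_kernel P
  by unfold_locales (rule symmetric)

lemma bij_\<Gamma>: "g \<in> \<Gamma> \<Longrightarrow> bij g"
  using subgroup.subset[OF subgroup_Aut] by (auto simp: Aut_group_def graph_auts_def)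

lemma nstep_translate:
  assumes "g \<in> \<Gamma>"
  shows "nstep P n (g x) = map_pmf g (nstep P n x)"
proof (induction n arbitrary: x)
  case (Suc n)
  have "P (g x) = map_pmf g (P x)" for x
  proof (rule pmf_eqI)
    fix z
    obtain y where "z = g y" using bij_\<Gamma>[OF assms] by (metis bij_pointE)
    then show "pmf (P (g x)) z = pmf (map_pmf g (P x)) z"
      using bij_\<Gamma>[OF assms] by (simp add: space_homogeneous[OF assms] pmf_map_inj' bij_is_inj)
  qed
  then show ?case by (simp add: bind_map_pmf map_bind_pmf Suc)
qed simp

lemma entropy_excess_nstep_base: "entropy_excess (nstep P n x) M = entropy_excess (nstep P n y) M"
proof -
  obtain g where "g \<in> \<Gamma>" "g x = y" using transitive_\<Gamma> by (auto simp: acts_transitively_def)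
  then show ?thesis using nstep_translate[of g n x] bij_\<Gamma>[of g]
    by (simp add: entropy_excess_map_inj bij_is_inj)
qed

lemma countable_vertices: "countable (UNIV :: 'v set)"
proof -
  have "(UNIV :: 'v set) = (\<Union>n. set_pmf (nstep P n v0))"
    using irreducible[of v0] by (auto simp: set_pmf_iff) (metis less_irrefl)
  then show ?thesis by (metis countable_UN countable_set_pmf countableI_type)
qed

lemma entropy_step_eq: "entropy_step P v n = entropy_pmf (nstep P n v)"
  by (simp add: entropy_step_def infsum_ennreal_eq_nn_integral[OF countable_vertices]
      entropy_pmf_count_space)

lemma entropy_excess_nstep_le:
  "entropy_excess (nstep P t v) (real t * M) \<le> of_nat t * entropy_excess (P v) M"
proof (induction t arbitrary: v)
  case 0
  show ?case by (simp add: entropy_excess_def)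
next
  case (Suc t)
  have "entropy_excess (nstep P (Suc t) v) (real (Suc t) * M)
      \<le> entropy_excess (P v) M + (\<integral>\<^sup>+y. entropy_excess (nstep P t y) (real t * M) \<partial>P v)"
    using entropy_excess_bind_le[of "P v" "nstep P t" M "real t * M"] by (simp add: algebra_simps)
  also have "\<dots> = entropy_excess (P v) M + entropy_excess (nstep P t v) (real t * M)"
    by (subst entropy_excess_nstep_base[of t _ _ v]) simp
  also have "\<dots> \<le> entropy_excess (P v) M + of_nat t * entropy_excess (P v) M"
    using Suc by (intro add_left_mono)
  finally show ?case by (simp add: algebra_simps)
qed

text \<open>Even times come from \<open>exists_trapping_set\<close> and \<open>log_convex_decay\<close>. Symmetry says nothing
  about odd return probabilities, which may vanish; a trapping set for an odd \<open>t\<close> is obtained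
  from one for \<open>t + 1\<close> by conditioning on the first step, and this costs the \<open>+ 1\<close>.\<close>
lemma trapping_set_of_return_bound:
  fixes \<gamma> :: "real \<Rightarrow> real"
  assumes "return_lower_bound P v0 \<gamma>" "n \<ge> 1" "\<gamma> (real n) \<ge> 0"
  shows "\<exists>A. finite A \<and> real (card A) \<le> 4 * exp (\<gamma> n) \<and>
             measure (nstep P t v0) (- A) \<le> (real t + 1) * \<gamma> n / n"
proof -
  define a where "a k = pmf (nstep P (2 * k) v0) v0" for k
  have lower: "a k \<ge> exp (- \<gamma> k)" if "k \<ge> 1" for k
    using assms(1) that by (simp add: a_def return_lower_bound_def)
  have a0: "a 0 = 1" by (simp add: a_def)
  have apos: "a k > 0" for k
    using lower[of k] a0 less_le_trans[OF exp_gt_zero] by (cases "k = 0") auto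
  have conv: "(a (k + 1))\<^sup>2 \<le> a k * a (k + 2)" for k
    unfolding a_def by (rule return_log_convex)
  have even: "\<exists>z A. finite A \<and> real (card A) \<le> 4 * exp (\<gamma> n) \<and>
             measure (nstep P (2 * s) z) (- A) \<le> 2 * real s * \<gamma> n / n" for s
  proof -
    obtain z A where A: "finite A" "real (card A) \<le> 4 / a n"
      and esc: "a n / 2 * measure (nstep P (2 * s) z) (- A) \<le> a n - a (n + s)"
      using exists_trapping_set[of n v0 s] apos[of n] unfolding a_def by blast
    have "a (n + s) \<ge> a n * (1 - real s * \<gamma> n / n)"
      by (rule log_convex_decay) (use apos conv a0 assms lower in auto)
    then have "a n - a (n + s) \<le> a n * (real s * \<gamma> n / n)"
      by (simp add: right_diff_distrib)
    with esc have "a n / 2 * measure (nstep P (2 * s) z) (- A) \<le> a n * (real s * \<gamma> n / n)"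
      by (rule order_trans)
    then have "a n * (measure (nstep P (2 * s) z) (- A) / 2) \<le> a n * (real s * \<gamma> n / n)"
      by simp
    then have "measure (nstep P (2 * s) z) (- A) / 2 \<le> real s * \<gamma> n / n"
      using apos[of n] by (simp only: mult_le_cancel_left_pos)
    then have "measure (nstep P (2 * s) z) (- A) \<le> 2 * real s * \<gamma> n / n"
      by (simp add: field_simps)
    moreover have "4 / a n \<le> 4 * exp (\<gamma> n)"
      using lower[OF assms(2)] apos[of n] by (simp add: exp_minus field_simps)
    ultimately show ?thesis using A by (meson order_trans)
  qed
  \<comment> \<open>the good starting vertex is arbitrary so far; it is moved to the base point at the end\<close>
  have "\<exists>z A. finite A \<and> real (card A) \<le> 4 * exp (\<gamma> n) \<and>
             measure (nstep P t z) (- A) \<le> (real t + 1) * \<gamma> n / n"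
  proof (cases "even t")
    case True
    then obtain s where t: "t = 2 * s" by (rule evenE)
    have "2 * real s * \<gamma> n / n \<le> (real t + 1) * \<gamma> n / n"
      using assms by (auto simp: t intro!: divide_right_mono mult_right_mono)
    then show ?thesis using even[of s] unfolding t by (meson order_trans)
  next
    case False
    then obtain s where t: "Suc t = 2 * s" by (metis even_Suc evenE)
    obtain z A where A: "finite A" "real (card A) \<le> 4 * exp (\<gamma> n)"
      and esc: "measure (nstep P (Suc t) z) (- A) \<le> (real t + 1) * \<gamma> n / n"
    proof -
      have "2 * real s = real t + 1" using t by linarith
      then show thesis using even[of s] that unfolding t[symmetric] by auto
    qed
    have "\<exists>y. measure (nstep P t y) (- A) \<le> (real t + 1) * \<gamma> n / n"
      by (rule exists_measure_le_of_bind[of "P z"])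
        (use esc assms in \<open>auto simp: measure_pmf.emeasure_eq_measure simp flip: nstep.simps emeasure_bind_pmf\<close>)
    then show ?thesis using A by blast
  qed
  then obtain z A where A: "finite A" "real (card A) \<le> 4 * exp (\<gamma> n)"
    and esc: "measure (nstep P t z) (- A) \<le> (real t + 1) * \<gamma> n / n" by blast
  obtain g where g: "g \<in> \<Gamma>" "g v0 = z" using transitive_\<Gamma> by (auto simp: acts_transitively_def)
  have inj: "inj g" using bij_\<Gamma>[OF g(1)] by (rule bij_is_inj)
  have "measure (nstep P t v0) (- (g -` A)) = measure (nstep P t z) (- A)"
    using nstep_translate[OF g(1), of t v0] g(2) by (simp add: vimage_Compl)
  moreover have "card (g -` A) \<le> card A"
    using card_vimage_inj_on_le[OF inj A(1)] by simp
  moreover have "finite (g -` A)" using A(1) inj by (rule finite_vimageI)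
  ultimately show ?thesis using A esc by (intro exI[of _ "g -` A"]) auto
qed

end

section \<open>Slow return decay and the Liouville property\<close>

text \<open>On \<open>A\<close> compare with the uniform density \<open>1 / N\<close>; outside \<open>A\<close> split the information
  at the level \<open>K\<close>.\<close>
lemma entropy_pmf_le_of_trapping:
  fixes p :: "'a pmf"
  assumes A: "finite A" "real (card A) \<le> N" and "N \<ge> 1" "K \<ge> 0"
    and out: "measure p (- A) \<le> \<delta>"
  shows "entropy_pmf p \<le> ennreal (ln N + 1 + K * \<delta>) + entropy_excess p K"
proof -
  have "\<delta> \<ge> 0" using out measure_nonneg[of p "- A"] by linarith
  have "entropy_pmf p \<le> (\<integral>\<^sup>+x. (ennreal (pmf p x) * ennreal (ln N) + ennreal (1 / N) * indicator A x)
      + (ennreal K * (ennreal (pmf p x) * indicator (- A) x)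
      + ennreal (pmf p x) * ennreal (- ln (pmf p x) - K)) \<partial>count_space UNIV)"
    unfolding entropy_pmf_count_space
  proof (intro nn_integral_mono)
    fix x
    let ?u = "pmf p x"
    show "ennreal (- (?u * ln ?u)) \<le> (ennreal ?u * ennreal (ln N) + ennreal (1 / N) * indicator A x)
      + (ennreal K * (ennreal ?u * indicator (- A) x) + ennreal ?u * ennreal (- ln ?u - K))"
    proof (cases "x \<in> A")
      case True
      have "- (?u * ln ?u) \<le> - (?u * ln (1 / N)) + 1 / N"
        using \<open>N \<ge> 1\<close> by (intro gibbs_inequality) auto
      then have "- (?u * ln ?u) \<le> ?u * ln N + 1 / N"
        using \<open>N \<ge> 1\<close> by (simp add: ln_div)
      then have "ennreal (- (?u * ln ?u)) \<le> ennreal (?u * ln N + 1 / N)" by (rule ennreal_leI)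
      also have "\<dots> = ennreal ?u * ennreal (ln N) + ennreal (1 / N) * indicator A x"
        using True \<open>N \<ge> 1\<close> by (simp add: ennreal_mult')
      finally show ?thesis by (simp add: add_increasing2)
    next
      case False
      have "- (?u * ln ?u) = K * ?u + ?u * (- ln ?u - K)" by (simp add: algebra_simps)
      then have "ennreal (- (?u * ln ?u)) \<le> ennreal (K * ?u) + ennreal (?u * (- ln ?u - K))"
        by (metis ennreal_add_le)
      also have "\<dots> = ennreal K * (ennreal ?u * indicator (- A) x) + ennreal ?u * ennreal (- ln ?u - K)"
        using False \<open>K \<ge> 0\<close> by (simp add: ennreal_mult')
      finally show ?thesis by (simp add: add_increasing)
    qed
  qed
  also have "\<dots> = (ennreal (ln N) + ennreal (1 / N) * of_nat (card A))
      + (ennreal K * emeasure p (- A) + entropy_excess p K)"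
  proof -
    have "(\<integral>\<^sup>+x. ennreal (pmf p x) * indicator (- A) x \<partial>count_space UNIV) = emeasure p (- A)"
      by (simp flip: nn_integral_measure_pmf)
    then show ?thesis
      using A(1) by (simp add: nn_integral_add nn_integral_cmult nn_integral_multc nn_integral_pmf
          entropy_excess_def nn_integral_measure_pmf)
  qed
  also have "\<dots> \<le> (ennreal (ln N) + ennreal 1) + (ennreal (K * \<delta>) + entropy_excess p K)"
  proof (intro add_mono order_refl)
    have "ennreal (1 / N) * of_nat (card A) = ennreal (1 / N * real (card A))"
      using \<open>N \<ge> 1\<close> by (simp add: ennreal_of_nat_eq_real_of_nat flip: ennreal_mult')
    also have "\<dots> \<le> ennreal 1" using A \<open>N \<ge> 1\<close> by (intro ennreal_leI) simp
    finally show "ennreal (1 / N) * of_nat (card A) \<le> ennreal 1" .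
    show "ennreal K * emeasure p (- A) \<le> ennreal (K * \<delta>)"
      using out \<open>K \<ge> 0\<close> unfolding measure_pmf.emeasure_eq_measure
      by (subst ennreal_mult'[symmetric]) (auto intro!: ennreal_leI mult_left_mono)
  qed
  also have "\<dots> = ennreal (ln N + 1 + K * \<delta>) + entropy_excess p K"
  proof -
    have "ennreal (ln N + 1 + K * \<delta>) = ennreal (ln N) + ennreal 1 + ennreal (K * \<delta>)"
      using \<open>N \<ge> 1\<close> \<open>K \<ge> 0\<close> \<open>\<delta> \<ge> 0\<close> by (subst ennreal_plus; simp)+
    then show ?thesis by (simp add: add.assoc)
  qed
  finally show ?thesis .
qed

text \<open>The factorisation \<open>u - v = (sqrt u - sqrt v) (sqrt u + sqrt v)\<close>, with the product split by
  the arithmetic--geometric mean inequality with weight \<open>s\<close>. Choosing \<open>s\<close> after summation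
  replaces Cauchy--Schwarz.\<close>
lemma abs_diff_le_hellinger_pointwise:
  fixes u v s :: real
  assumes "u \<ge> 0" "v \<ge> 0" "s > 0"
  shows "\<bar>u - v\<bar> \<le> (sqrt u - sqrt v)\<^sup>2 / (4 * s) + 2 * s * (u + v)"
proof -
  define a b where "a = sqrt u" and "b = sqrt v"
  have "a \<ge> 0" "b \<ge> 0" and uv: "u = a\<^sup>2" "v = b\<^sup>2" using assms by (simp_all add: a_def b_def)
  have "\<bar>u - v\<bar> = \<bar>a - b\<bar> * (a + b)"
    using \<open>a \<ge> 0\<close> \<open>b \<ge> 0\<close> by (simp add: uv power2_eq_square abs_mult square_diff_square_factored mult.commute)
  also have "\<dots> \<le> (a - b)\<^sup>2 / (4 * s) + s * (a + b)\<^sup>2"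
  proof -
    have "0 \<le> (\<bar>a - b\<bar> - 2 * s * (a + b))\<^sup>2" by simp
    then have "4 * s * (\<bar>a - b\<bar> * (a + b)) \<le> (a - b)\<^sup>2 + 4 * s * (s * (a + b)\<^sup>2)"
      by (simp add: power2_diff power_mult_distrib) (simp add: power2_eq_square algebra_simps)
    then show ?thesis using \<open>s > 0\<close> by (simp add: field_simps)
  qed
  also have "s * (a + b)\<^sup>2 \<le> 2 * s * (u + v)"
  proof -
    have "(a + b)\<^sup>2 \<le> 2 * (u + v)"
      using zero_le_power2[of "a - b"] unfolding uv by (simp add: power2_diff power2_sum)
    then show ?thesis using mult_left_mono[of "(a + b)\<^sup>2" "2 * (u + v)" s] \<open>s > 0\<close> by simp
  qed
  finally show ?thesis by (simp add: a_def b_def)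
qed

lemma nn_integral_diff_le_hellinger:
  fixes p q :: "'a pmf"
  assumes k: "\<And>x. 0 \<le> k x" "\<And>x. k x \<le> B" and "s > 0" "B \<ge> 0"
  shows "(\<integral>\<^sup>+x. ennreal (k x) \<partial>p)
    \<le> (\<integral>\<^sup>+x. ennreal (k x) \<partial>q) + (ennreal (B / (4 * s)) * hellinger p q + ennreal (4 * B * s))"
proof -
  have "(\<integral>\<^sup>+x. ennreal (k x) \<partial>p) \<le> (\<integral>\<^sup>+x. ennreal (pmf q x) * ennreal (k x)
      + (ennreal (B / (4 * s)) * ennreal ((sqrt (pmf p x) - sqrt (pmf q x))\<^sup>2)
      + (ennreal (2 * B * s) * ennreal (pmf p x) + ennreal (2 * B * s) * ennreal (pmf q x))) \<partial>count_space UNIV)"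
    unfolding nn_integral_measure_pmf
  proof (intro nn_integral_mono)
    fix x
    let ?u = "pmf p x" and ?v = "pmf q x"
    have "?u * k x - ?v * k x \<le> \<bar>?u - ?v\<bar> * k x"
      using k(1)[of x] by (simp add: mult_right_mono flip: left_diff_distrib)
    also have "\<dots> \<le> ((sqrt ?u - sqrt ?v)\<^sup>2 / (4 * s) + 2 * s * (?u + ?v)) * B"
      using k \<open>s > 0\<close> by (intro mult_mono abs_diff_le_hellinger_pointwise) (auto intro!: add_nonneg_nonneg)
    also have "\<dots> = B / (4 * s) * (sqrt ?u - sqrt ?v)\<^sup>2 + (2 * B * s * ?u + 2 * B * s * ?v)"
      by (simp add: algebra_simps)
    finally have "?u * k x \<le> ?v * k x + (B / (4 * s) * (sqrt ?u - sqrt ?v)\<^sup>2 + (2 * B * s * ?u + 2 * B * s * ?v))"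
      by linarith
    then have "ennreal (?u * k x) \<le> ennreal (?v * k x + (B / (4 * s) * (sqrt ?u - sqrt ?v)\<^sup>2 + (2 * B * s * ?u + 2 * B * s * ?v)))"
      by (rule ennreal_leI)
    then show "ennreal ?u * ennreal (k x) \<le> ennreal ?v * ennreal (k x)
      + (ennreal (B / (4 * s)) * ennreal ((sqrt ?u - sqrt ?v)\<^sup>2)
      + (ennreal (2 * B * s) * ennreal ?u + ennreal (2 * B * s) * ennreal ?v))"
      using k(1)[of x] \<open>s > 0\<close> \<open>B \<ge> 0\<close> by (simp add: add_nonneg_nonneg flip: ennreal_mult ennreal_plus)
  qed
  also have "\<dots> = (\<integral>\<^sup>+x. ennreal (k x) \<partial>q) + (ennreal (B / (4 * s)) * hellinger p q
      + (ennreal (2 * B * s) + ennreal (2 * B * s)))"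
    by (simp add: nn_integral_add nn_integral_cmult nn_integral_pmf hellinger_def nn_integral_measure_pmf)
  also have "ennreal (2 * B * s) + ennreal (2 * B * s) = ennreal (4 * B * s)"
    using \<open>s > 0\<close> \<open>B \<ge> 0\<close> by (simp flip: ennreal_plus)
  finally show ?thesis .
qed

lemma hellinger_ge_of_expectations:
  fixes p q :: "'a pmf"
  assumes k: "\<And>x. 0 \<le> k x" "\<And>x. k x \<le> B" and "B > 0"
    and p: "(\<integral>\<^sup>+x. ennreal (k x) \<partial>p) = ennreal (a + d)" and q: "(\<integral>\<^sup>+x. ennreal (k x) \<partial>q) = ennreal a"
    and "a \<ge> 0" "d > 0"
  shows "ennreal (d\<^sup>2 / (4 * B\<^sup>2)) \<le> hellinger p q"
proof (cases "hellinger p q")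
  case (real r)
  \<comment> \<open>this weight makes the term \<open>4 B s\<close> absorb exactly half of \<open>d\<close>\<close>
  define s where "s = d / (8 * B)"
  have "s > 0" using assms by (simp add: s_def)
  have "ennreal (a + d) \<le> ennreal a + (ennreal (B / (4 * s)) * ennreal r + ennreal (4 * B * s))"
    using nn_integral_diff_le_hellinger[where k = k and B = B and p = p and q = q, OF k \<open>s > 0\<close>] \<open>B > 0\<close> p q real by simp
  also have "\<dots> = ennreal (a + (B / (4 * s) * r + 4 * B * s))"
    using \<open>s > 0\<close> \<open>B > 0\<close> \<open>a \<ge> 0\<close> real by (simp add: add_nonneg_nonneg flip: ennreal_mult ennreal_plus)
  finally have "d \<le> B / (4 * s) * r + 4 * B * s"
    using \<open>s > 0\<close> \<open>B > 0\<close> \<open>a \<ge> 0\<close> \<open>d > 0\<close> real by (subst (asm) ennreal_le_iff) (auto intro!: add_nonneg_nonneg)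
  also have "4 * B * s = d / 2" using \<open>B > 0\<close> by (simp add: s_def)
  also have "B / (4 * s) = 2 * B\<^sup>2 / d" using \<open>B > 0\<close> \<open>d > 0\<close> by (simp add: s_def power2_eq_square)
  finally have "d / 2 \<le> 2 * B\<^sup>2 / d * r" by simp
  then have "d\<^sup>2 / (4 * B\<^sup>2) \<le> r"
    using \<open>B > 0\<close> \<open>d > 0\<close> by (simp add: field_simps power2_eq_square)
  then show ?thesis using real by (simp add: ennreal_leI)
qed simp

text \<open>Adding the bound \<open>B\<close> makes a bounded harmonic function nonnegative, so that iterating
  harmonicity is a matter of nonnegative integrals.\<close>
lemma nn_integral_eq_of_infsum:
  fixes p :: "'a pmf" and h :: "'a \<Rightarrow> real"
  assumes h: "\<And>y. \<bar>h y\<bar> \<le> B" and mean: "m = (\<Sum>\<^sub>\<infinity>y. pmf p y * h y)"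
  shows "(\<integral>\<^sup>+y. ennreal (h y + B) \<partial>p) = ennreal (m + B)"
proof -
  have int: "integrable p h"
    by (rule measure_pmf.integrable_const_bound[where B = B]) (use h in auto)
  then have "integrable (count_space UNIV) (\<lambda>y. pmf p y * h y)"
    unfolding measure_pmf_eq_density by (subst (asm) integrable_density) auto
  then have summable: "Infinite_Set_Sum.abs_summable_on (\<lambda>y. pmf p y * h y) UNIV"
    by (simp add: abs_summable_on_def)
  have "m = (LINT y|count_space UNIV. pmf p y * h y)"
    using infsetsum_infsum[OF summable] mean by (simp add: infsetsum_def)
  also have "\<dots> = (LINT y|p. h y)"
    unfolding measure_pmf_eq_density by (subst integral_density) auto
  finally have "(LINT y|p. h y + B) = m + B" using int by simp
  moreover have "0 \<le> h y + B" for y using h[of y] by (simp add: abs_le_iff)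
  ultimately show ?thesis using int by (subst nn_integral_eq_integral) auto
qed

context homogeneous_walk
begin

lemma entropy_increment_ge:
  "entropy_pmf (nstep P t x) + ennreal (pmf (P x) y) * hellinger (nstep P t y) (nstep P (Suc t) x)
    \<le> entropy_pmf (nstep P (Suc t) x)"
proof -
  let ?hell = "\<lambda>y. hellinger (nstep P t y) (nstep P (Suc t) x)"
  have "ennreal (pmf (P x) y) * ?hell y
      = (\<integral>\<^sup>+z. ennreal (pmf (P x) z) * ?hell z * indicator {y} z \<partial>count_space UNIV)"
    by (subst nn_integral_count_space'[of "{y}"]) auto
  also have "\<dots> \<le> (\<integral>\<^sup>+z. ?hell z \<partial>P x)"
    unfolding nn_integral_measure_pmf by (intro nn_integral_mono) (auto simp: indicator_def)
  finally have "entropy_pmf (nstep P t x) + ennreal (pmf (P x) y) * ?hell y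
      \<le> (\<integral>\<^sup>+z. entropy_pmf (nstep P t x) + ?hell z \<partial>P x)"
    by (simp add: nn_integral_add add_left_mono)
  also have "\<dots> = (\<integral>\<^sup>+z. entropy_pmf (nstep P t z) + ?hell z \<partial>P x)"
    by (subst entropy_excess_nstep_base[of t _ _ x]) simp
  also have "\<dots> \<le> entropy_pmf (nstep P (Suc t) x)"
    using entropy_bind_ge[where p = "P x" and K = "nstep P t"] by simp
  finally show ?thesis .
qed

text \<open>The trapping set for \<open>n = t\<^sup>2\<close> contributes \<open>\<gamma>(t\<^sup>2) = o(t)\<close>. Outside it, information up
  to \<open>m\<close> per step contributes at most \<open>t m\<close> times a probability of order
  \<open>\<gamma>(t\<^sup>2) / t\<close>, and the rest is at most \<open>t\<close> times the tail of the information of a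
  single step above \<open>m\<close>, which is small for large \<open>m\<close>.\<close>
lemma entropy_sublinear:
  fixes \<gamma> :: "real \<Rightarrow> real"
  assumes low: "return_lower_bound P v0 \<gamma>" and pos: "\<And>t. t \<ge> 1 \<Longrightarrow> \<gamma> t > 0"
    and lim: "((\<lambda>t. \<gamma> t / t powr (1/2)) \<longlongrightarrow> 0) at_top" and "\<epsilon> > 0"
  shows "\<forall>\<^sub>F t in sequentially. entropy_pmf (nstep P t v0) \<le> ennreal (\<epsilon> * real t)"
proof -
  have "entropy_pmf (P v0) < \<infinity>"
    using finite_entropy nstep_1[of P v0] by (simp add: entropy_step_eq)
  from entropy_excess_tendsto_0[OF this]
  have "\<forall>\<^sub>F m in sequentially. entropy_excess (P v0) (real m) < ennreal (\<epsilon> / 2)"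
    by (rule order_tendstoD) (use \<open>\<epsilon> > 0\<close> in simp)
  then obtain m :: nat where m: "entropy_excess (P v0) (real m) < ennreal (\<epsilon> / 2)"
    by (auto simp: eventually_sequentially)
  have "filterlim (\<lambda>t::nat. (real t)\<^sup>2) at_top sequentially"
    by real_asymp
  from filterlim_compose[OF lim this]
  have "(\<lambda>t::nat. \<gamma> ((real t)\<^sup>2) / ((real t)\<^sup>2) powr (1/2)) \<longlonglongrightarrow> 0" .
  moreover have "\<forall>\<^sub>F t::nat in sequentially.
      \<gamma> ((real t)\<^sup>2) / ((real t)\<^sup>2) powr (1/2) = \<gamma> ((real t)\<^sup>2) / real t"
    using eventually_gt_at_top[of 0]
    by eventually_elim (simp add: powr_half_sqrt)
  ultimately have lim': "(\<lambda>t::nat. \<gamma> ((real t)\<^sup>2) / real t) \<longlonglongrightarrow> 0"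
    by (rule Lim_transform_eventually)
  have "(\<lambda>t::nat. (ln 4 + 1) / real t + (2 * real m + 1) * (\<gamma> ((real t)\<^sup>2) / real t)) \<longlonglongrightarrow> 0 + (2 * real m + 1) * 0"
    by (intro tendsto_add tendsto_mult tendsto_const lim') real_asymp
  then have "\<forall>\<^sub>F t::nat in sequentially.
      (ln 4 + 1) / real t + (2 * real m + 1) * (\<gamma> ((real t)\<^sup>2) / real t) < \<epsilon> / 2"
    by (rule order_tendstoD) (use \<open>\<epsilon> > 0\<close> in simp)
  then show ?thesis
    using eventually_ge_at_top[of 1]
  proof eventually_elim
    case (elim t)
    define g where "g = \<gamma> ((real t)\<^sup>2)"
    have "g > 0" unfolding g_def by (rule pos) (use elim in simp)
    have t2: "real (t\<^sup>2) = (real t)\<^sup>2" by simp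
    have "1 \<le> t\<^sup>2" using elim by simp
    then obtain A where A: "finite A" "real (card A) \<le> 4 * exp g"
      and esc: "measure (nstep P t v0) (- A) \<le> (real t + 1) * g / (real t)\<^sup>2"
      using trapping_set_of_return_bound[OF low, of "t\<^sup>2" t] \<open>g > 0\<close> unfolding t2 g_def[symmetric] by auto
    have "entropy_pmf (nstep P t v0)
        \<le> ennreal (ln (4 * exp g) + 1 + real t * real m * ((real t + 1) * g / (real t)\<^sup>2))
          + entropy_excess (nstep P t v0) (real t * real m)"
    proof (rule entropy_pmf_le_of_trapping[OF A _ _ esc])
      have "1 \<le> exp g" using \<open>g > 0\<close> by simp
      then show "1 \<le> 4 * exp g" by linarith
    qed simp
    also have "\<dots> \<le> ennreal (\<epsilon> / 2 * real t) + ennreal (\<epsilon> / 2 * real t)"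
    proof (intro add_mono ennreal_leI)
      have "real t * real m * ((real t + 1) * g / (real t)\<^sup>2) = real m * ((real t + 1) * g) / real t"
        using elim by (simp add: field_simps power2_eq_square)
      also have "\<dots> \<le> real m * ((2 * real t) * g) / real t"
        using elim \<open>g > 0\<close> by (intro divide_right_mono mult_left_mono mult_right_mono) auto
      also have "\<dots> = 2 * real m * g" using elim by simp
      finally have "ln (4 * exp g) + 1 + real t * real m * ((real t + 1) * g / (real t)\<^sup>2)
          \<le> ln 4 + g + 1 + 2 * real m * g"
        by (simp add: ln_mult)
      also have "\<dots> = ((ln 4 + 1) / real t + (2 * real m + 1) * (g / real t)) * real t"
        using elim(2) by (simp add: field_simps)
      also have "\<dots> \<le> \<epsilon> / 2 * real t"
        using elim unfolding g_def by (intro mult_right_mono) auto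
      finally show "ln (4 * exp g) + 1 + real t * real m * ((real t + 1) * g / (real t)\<^sup>2) \<le> \<epsilon> / 2 * real t" .
      have "entropy_excess (nstep P t v0) (real t * real m) \<le> of_nat t * entropy_excess (P v0) (real m)"
        by (rule entropy_excess_nstep_le)
      also have "\<dots> \<le> of_nat t * ennreal (\<epsilon> / 2)"
        using m by (intro mult_left_mono) (auto simp: less_imp_le)
      also have "\<dots> = ennreal (\<epsilon> / 2 * real t)"
        using \<open>\<epsilon> > 0\<close> by (simp add: ennreal_of_nat_eq_real_of_nat mult.commute flip: ennreal_mult')
      finally show "entropy_excess (nstep P t v0) (real t * real m) \<le> ennreal (\<epsilon> / 2 * real t)" .
    qed
    also have "\<dots> = ennreal (\<epsilon> * real t)"
      using \<open>\<epsilon> > 0\<close> by (simp flip: ennreal_plus)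
    finally show ?case .
  qed
qed

text \<open>If a bounded harmonic function differs at the ends of a transition \<open>x \<rightarrow> y\<close>, then for all
  \<open>t\<close> it separates the law at time \<open>t\<close> from \<open>y\<close> and the law at time \<open>t + 1\<close>
  from \<open>x\<close> by the same amount. Every entropy increment is then at least a fixed positive
  constant.\<close>
lemma liouville_of_sublinear_entropy:
  assumes sub: "\<And>\<epsilon>. \<epsilon> > 0 \<Longrightarrow> \<forall>\<^sub>F t in sequentially. entropy_pmf (nstep P t v0) \<le> ennreal (\<epsilon> * real t)"
  shows "liouville P"
  unfolding liouville_def
proof (intro allI impI, elim conjE)
  fix h :: "'v \<Rightarrow> real"
  assume bdd: "bounded (range h)" and harmonic: "\<forall>x. h x = (\<Sum>\<^sub>\<infinity>y. pmf (P x) y * h y)"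
  obtain B where "B > 0" and B: "\<bar>h y\<bar> \<le> B" for y
    using bdd by (auto simp: bounded_pos)
  define k where "k y = h y + B" for y
  have k: "0 \<le> k y" "k y \<le> 2 * B" for y
    using B[of y] by (auto simp: k_def abs_le_iff)
  have k_step: "(\<integral>\<^sup>+y. ennreal (k y) \<partial>P x) = ennreal (k x)" for x
    unfolding k_def by (rule nn_integral_eq_of_infsum[OF B spec[OF harmonic]])
  have k_nstep: "(\<integral>\<^sup>+y. ennreal (k y) \<partial>nstep P n x) = ennreal (k x)" for n x
    by (induction n arbitrary: x) (simp_all add: k_step)
  have edge: "h x = h y" if "pmf (P x) y > 0" for x y
  proof (rule ccontr)
    assume "h x \<noteq> h y"
    define \<eta> where "\<eta> = (h x - h y)\<^sup>2 / (4 * (2 * B)\<^sup>2)"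
    have "\<eta> > 0" using \<open>h x \<noteq> h y\<close> \<open>B > 0\<close> by (simp add: \<eta>_def)
    have far: "ennreal \<eta> \<le> hellinger (nstep P t y) (nstep P (Suc t) x)" for t
    proof (cases "h x < h y")
      case True
      have "ennreal ((h y - h x)\<^sup>2 / (4 * (2 * B)\<^sup>2)) \<le> hellinger (nstep P t y) (nstep P (Suc t) x)"
        by (rule hellinger_ge_of_expectations[OF k _ _ k_nstep[of "Suc t" x]])
          (use True \<open>B > 0\<close> k in \<open>simp_all only: k_nstep, simp_all add: k_def add.commute\<close>)
      then show ?thesis by (simp add: \<eta>_def power2_commute)
    next
      case False
      have "ennreal ((h x - h y)\<^sup>2 / (4 * (2 * B)\<^sup>2)) \<le> hellinger (nstep P (Suc t) x) (nstep P t y)"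
        by (rule hellinger_ge_of_expectations[OF k _ _ k_nstep[of t y]])
          (use False \<open>h x \<noteq> h y\<close> \<open>B > 0\<close> k in \<open>simp_all only: k_nstep, simp_all add: k_def add.commute\<close>)
      then show ?thesis by (simp add: \<eta>_def hellinger_commute)
    qed
    define c where "c = pmf (P x) y * \<eta>"
    have "c > 0" using that \<open>\<eta> > 0\<close> by (simp add: c_def)
    have growth: "ennreal (c * real t) \<le> entropy_pmf (nstep P t x)" for t
    proof (induction t)
      case (Suc t)
      have "ennreal (c * real (Suc t)) = ennreal (c * real t) + ennreal (pmf (P x) y) * ennreal \<eta>"
        using \<open>c > 0\<close> \<open>\<eta> > 0\<close>
        by (simp add: c_def algebra_simps flip: ennreal_mult ennreal_plus)
      also have "\<dots> \<le> entropy_pmf (nstep P t x)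
          + ennreal (pmf (P x) y) * hellinger (nstep P t y) (nstep P (Suc t) x)"
        by (intro add_mono mult_left_mono Suc far) simp
      also have "\<dots> \<le> entropy_pmf (nstep P (Suc t) x)" by (rule entropy_increment_ge)
      finally show ?case .
    qed simp
    have "\<forall>\<^sub>F t in sequentially. entropy_pmf (nstep P t v0) \<le> ennreal (c / 2 * real t) \<and> t \<ge> 1"
      using sub[of "c / 2"] \<open>c > 0\<close> eventually_ge_at_top[of 1] by (simp add: eventually_conj_iff)
    then obtain t where t: "entropy_pmf (nstep P t v0) \<le> ennreal (c / 2 * real t)" "t \<ge> 1"
      by (auto simp: eventually_sequentially)
    have "ennreal (c * real t) \<le> ennreal (c / 2 * real t)"
      using growth[of t] t(1) unfolding entropy_excess_nstep_base[of t x 0 v0] by (rule order_trans)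
    then show False using \<open>c > 0\<close> t(2) by (simp add: ennreal_le_iff)
  qed
  have path: "h x = h y" if "y \<in> set_pmf (nstep P n x)" for n x y
    using that
  proof (induction n arbitrary: x)
    case (Suc n)
    then obtain z where "z \<in> set_pmf (P x)" "y \<in> set_pmf (nstep P n z)" by (auto simp: set_bind_pmf)
    then show ?case using edge[of x z] Suc.IH[of z] by (simp add: pmf_positive)
  qed simp
  have "h x = h v0" for x
    using irreducible[of v0 x] path[of x _ v0] by (auto simp: pmf_positive_iff)
  then show "\<exists>c. \<forall>x. h x = c" by blast
qed

end

section \<open>Entropy bounds from trapping sets at all scales\<close>

text \<open>Shannon coding: a vertex is described by the first \<open>k\<close> with \<open>x \<in> A k\<close>, at a cost of
  \<open>(k + 1) ln 2\<close>, followed by its position in \<open>A k\<close>, at a cost of \<open>L k\<close>. The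
  exponentials of the negative costs sum to at most \<open>1\<close>, and scale \<open>k + 1\<close> is used only
  off \<open>A k\<close>, hence with probability at most \<open>\<delta> k\<close>.\<close>
lemma entropy_pmf_le_multiscale:
  fixes p :: "'a pmf" and A :: "nat \<Rightarrow> 'a set" and L \<delta> :: "nat \<Rightarrow> real"
  assumes A: "\<And>k. finite (A k)" "\<And>k. real (card (A k)) \<le> exp (L k)"
    and L: "\<And>k. L k \<ge> 0" and out: "\<And>k. measure p (- A k) \<le> \<delta> k" and lim: "\<delta> \<longlonglongrightarrow> 0"
    and summ: "summable (\<lambda>k. \<delta> k * (L (Suc k) + real (k + 2) * ln 2))"
  shows "entropy_pmf p \<le> ennreal (L 0 + ln 2 + (\<Sum>k. \<delta> k * (L (Suc k) + real (k + 2) * ln 2)) + 1)"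
proof -
  define cost where "cost k = L k + real (k + 1) * ln 2" for k
  define scale where "scale x = (LEAST k. x \<in> A k)" for x
  define q where "q x = (if \<exists>k. x \<in> A k then exp (- cost (scale x)) else 0)" for x
  have cost0: "cost k \<ge> 0" for k using L by (simp add: cost_def)
  have \<delta>0: "\<delta> k \<ge> 0" for k using out[of k] measure_nonneg[of p "- A k"] by linarith
  have summ': "summable (\<lambda>k. \<delta> k * cost (Suc k))"
    using summ by (simp add: cost_def add_ac)
  have term_le: "f k \<le> suminf f" for f :: "nat \<Rightarrow> ennreal" and k
    using sum_le_suminf[of f "{k}"] by (simp add: summableI)
  have covered: "\<exists>k. x \<in> A k" if "x \<in> set_pmf p" for x
  proof (rule ccontr)
    assume "\<nexists>k. x \<in> A k"
    then have "pmf p x \<le> \<delta> k" for k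
      using out[of k] measure_pmf.finite_measure_mono[of "{x}" "- A k" p] by (simp add: pmf.rep_eq)
    then have "pmf p x \<le> 0" using lim by (intro LIMSEQ_le_const) auto
    then show False using that by (simp add: set_pmf_iff)
  qed
  have q_sum: "(\<integral>\<^sup>+x. ennreal (q x) \<partial>count_space UNIV) \<le> 1"
  proof -
    have "(\<integral>\<^sup>+x. ennreal (q x) \<partial>count_space UNIV)
        \<le> (\<integral>\<^sup>+x. (\<Sum>k. ennreal (exp (- cost k)) * indicator (A k) x) \<partial>count_space UNIV)"
    proof (intro nn_integral_mono)
      fix x
      show "ennreal (q x) \<le> (\<Sum>k. ennreal (exp (- cost k)) * indicator (A k) x)"
      proof (cases "\<exists>k. x \<in> A k")
        case True
        then have "x \<in> A (scale x)" unfolding scale_def by (rule LeastI_ex)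
        then have "ennreal (q x) = ennreal (exp (- cost (scale x))) * indicator (A (scale x)) x"
          using True by (simp add: q_def)
        also have "\<dots> \<le> (\<Sum>k. ennreal (exp (- cost k)) * indicator (A k) x)" by (rule term_le)
        finally show ?thesis .
      qed (simp add: q_def)
    qed
    also have "\<dots> = (\<Sum>k. ennreal (exp (- cost k)) * of_nat (card (A k)))"
      using A by (simp add: nn_integral_suminf nn_integral_cmult)
    also have "\<dots> \<le> (\<Sum>k. ennreal ((1/2) ^ Suc k))"
    proof (intro suminf_le summableI)
      fix k
      have "exp (real (Suc k) * ln 2) = (2 :: real) ^ Suc k"
        by (subst exp_of_nat_mult) simp
      moreover have "- cost k = - L k + - (real (Suc k) * ln 2)" by (simp add: cost_def)
      ultimately have "exp (- cost k) = exp (- L k) * inverse (2 ^ Suc k)"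
        by (metis exp_add exp_minus)
      then have "exp (- cost k) * real (card (A k)) \<le> exp (- L k) * inverse (2 ^ Suc k) * exp (L k)"
        using A(2)[of k] by (simp only:) (intro mult_left_mono, auto)
      also have "\<dots> = inverse (2 ^ Suc k)" by (simp add: exp_minus)
      also have "\<dots> = (1/2) ^ Suc k" by (simp only: power_one_over inverse_eq_divide)
      finally have "exp (- cost k) * real (card (A k)) \<le> (1/2) ^ Suc k" .
      then show "ennreal (exp (- cost k)) * of_nat (card (A k)) \<le> ennreal ((1/2) ^ Suc k)"
        by (simp add: ennreal_of_nat_eq_real_of_nat ennreal_leI del: power_Suc flip: ennreal_mult')
    qed
    also have "\<dots> = ennreal (\<Sum>k. (1/2) ^ Suc k)"
      using power_half_series by (intro suminf_ennreal2) (auto simp: sums_iff)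
    also have "\<dots> = 1" using power_half_series by (simp add: sums_iff)
    finally show ?thesis .
  qed
  have "entropy_pmf p \<le> (\<integral>\<^sup>+x. ennreal (- ln (q x)) \<partial>p) + 1"
    by (rule entropy_pmf_le_cross_entropy[OF _ _ q_sum]) (use covered in \<open>auto simp: q_def\<close>)
  also have "(\<integral>\<^sup>+x. ennreal (- ln (q x)) \<partial>p)
      \<le> (\<integral>\<^sup>+x. ennreal (cost 0) + (\<Sum>k. ennreal (cost (Suc k)) * indicator (- A k) x) \<partial>p)"
  proof (intro nn_integral_mono_AE, unfold AE_measure_pmf_iff, intro ballI)
    fix x assume x: "x \<in> set_pmf p"
    then have "- ln (q x) = cost (scale x)" using covered by (auto simp: q_def)
    moreover have "ennreal (cost (scale x))
        \<le> ennreal (cost 0) + (\<Sum>k. ennreal (cost (Suc k)) * indicator (- A k) x)"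
    proof (cases "scale x")
      case (Suc k)
      then have "x \<notin> A k" unfolding scale_def by (intro not_less_Least) simp
      then have "ennreal (cost (scale x)) = ennreal (cost (Suc k)) * indicator (- A k) x" using Suc by simp
      also have "\<dots> \<le> (\<Sum>k. ennreal (cost (Suc k)) * indicator (- A k) x)" by (rule term_le)
      finally show ?thesis by (simp add: add_increasing)
    qed simp
    ultimately show "ennreal (- ln (q x))
        \<le> ennreal (cost 0) + (\<Sum>k. ennreal (cost (Suc k)) * indicator (- A k) x)" by simp
  qed
  also have "\<dots> = ennreal (cost 0) + (\<Sum>k. ennreal (cost (Suc k)) * emeasure p (- A k))"
    by (simp add: nn_integral_add nn_integral_suminf nn_integral_cmult)
  also have "(\<Sum>k. ennreal (cost (Suc k)) * emeasure p (- A k)) \<le> (\<Sum>k. ennreal (\<delta> k * cost (Suc k)))"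
  proof (intro suminf_le summableI)
    fix k
    show "ennreal (cost (Suc k)) * emeasure p (- A k) \<le> ennreal (\<delta> k * cost (Suc k))"
      using mult_right_mono[OF out[of k] cost0[of "Suc k"]] cost0[of "Suc k"]
      by (simp add: measure_pmf.emeasure_eq_measure mult.commute ennreal_leI flip: ennreal_mult')
  qed
  also have "\<dots> = ennreal (\<Sum>k. \<delta> k * cost (Suc k))"
    by (intro suminf_ennreal2 mult_nonneg_nonneg \<delta>0 cost0 summ')
  also have "ennreal (cost 0) + ennreal (\<Sum>k. \<delta> k * cost (Suc k)) + 1
      = ennreal (cost 0 + (\<Sum>k. \<delta> k * cost (Suc k)) + 1)"
  proof -
    have "0 \<le> (\<Sum>k. \<delta> k * cost (Suc k))"
      by (intro suminf_nonneg mult_nonneg_nonneg \<delta>0 cost0 summ')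
    then show ?thesis using cost0[of 0] by (simp add: ennreal_plus)
  qed
  finally show ?thesis by (simp add: cost_def add_mono add_ac)
qed

text \<open>With \<open>b = 2\<^sup>\<beta>\<close>, the two nonconstant terms come from summing over the scales: the series is the
  cost of encoding the scale, and the last term is the geometric series with ratio \<open>b\<^sup>2/2\<close>,
  whose convergence is the condition \<open>\<beta> < 1/2\<close>.\<close>
definition entropy_bound_const :: "real \<Rightarrow> real" where
  "entropy_bound_const b = 4 + (\<Sum>k. 2 * ((b / 2) ^ k * (real (k + 4) * ln 2))) + 2 * b / (1 - b\<^sup>2 / 2)"

context homogeneous_walk
begin

text \<open>At scale \<open>2\<^sup>k m\<close> the cost is about \<open>b\<^sup>k \<gamma>(m)\<close> and the escape probability at most
  \<open>2 (b/2)\<^sup>k\<close>. Their product decays like \<open>(b\<^sup>2/2)\<^sup>k\<close>, so the scale \<open>k = 0\<close> decides.\<close>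
lemma entropy_le_of_polynomial_return_bound:
  fixes \<gamma> :: "real \<Rightarrow> real" and b :: real
  assumes low: "return_lower_bound P v0 \<gamma>" and pos: "\<And>t. t \<ge> 1 \<Longrightarrow> \<gamma> t > 0"
    and b: "b \<ge> 1" "b\<^sup>2 < 2" and doubling: "\<And>t. t \<ge> 1 \<Longrightarrow> \<gamma> (2 * t) \<le> b * \<gamma> t"
    and m: "m \<ge> 1" and t: "t \<ge> 1" and small: "real t * \<gamma> (real m) \<le> real m"
  shows "entropy_pmf (nstep P t v0)
    \<le> ennreal (entropy_bound_const b * (\<gamma> m + 1))"
proof -
  define G where "G = \<gamma> m"
  define S where "S = (\<Sum>k. 2 * ((b / 2) ^ k * (real (k + 4) * ln 2)))"
  define L where "L k = ln 4 + b ^ k * G" for k :: nat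
  define \<delta> where "\<delta> k = 2 * (b / 2) ^ k" for k :: nat
  have "b < 2" using b using power_mono[of 2 b 2] by (cases "b < 2") auto
  have "G > 0" unfolding G_def using m by (intro pos) simp
  have level: "1 \<le> 2 ^ k * real m" for k :: nat
    using m by (simp add: order_trans[OF _ mult_mono[of 1 "2 ^ k" 1 "real m"]])
  have scaled: "\<gamma> (2 ^ k * real m) \<le> b ^ k * G" for k
  proof (induction k)
    case (Suc k)
    have "\<gamma> (2 ^ Suc k * real m) \<le> b * \<gamma> (2 ^ k * real m)"
      using doubling[OF level[of k]] by (simp add: mult.assoc)
    also have "\<dots> \<le> b * (b ^ k * G)" using Suc b by (intro mult_left_mono) auto
    finally show ?case by (simp add: mult.assoc)
  qed (simp add: G_def)
  have "\<exists>A. finite A \<and> real (card A) \<le> exp (L k) \<and> measure (nstep P t v0) (- A) \<le> \<delta> k" for k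
  proof -
    have cast: "real (2 ^ k * m) = 2 ^ k * real m" by simp
    have "1 \<le> 2 ^ k * m" using m by simp
    then obtain A where A: "finite A" "real (card A) \<le> 4 * exp (\<gamma> (2 ^ k * real m))"
      and esc: "measure (nstep P t v0) (- A) \<le> (real t + 1) * \<gamma> (2 ^ k * real m) / (2 ^ k * real m)"
      using trapping_set_of_return_bound[OF low, of "2 ^ k * m" t] pos[OF level[of k]]
      unfolding cast by auto
    have "4 * exp (\<gamma> (2 ^ k * real m)) \<le> exp (L k)"
      using scaled[of k] by (simp add: L_def exp_add)
    moreover have "(real t + 1) * \<gamma> (2 ^ k * real m) / (2 ^ k * real m) \<le> \<delta> k"
    proof -
      have "(real t + 1) * \<gamma> (2 ^ k * real m) \<le> (2 * real t) * (b ^ k * G)"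
        using t scaled[of k] pos[OF level[of k]] by (intro mult_mono) auto
      also have "\<dots> = 2 * b ^ k * (real t * G)" by simp
      also have "\<dots> \<le> 2 * b ^ k * real m"
        using small b unfolding G_def by (intro mult_left_mono) auto
      also have "\<dots> = \<delta> k * (2 ^ k * real m)" by (simp add: \<delta>_def power_divide)
      finally show ?thesis using m by (simp add: pos_divide_le_eq)
    qed
    ultimately show ?thesis using A esc by (meson order_trans)
  qed
  then obtain A where A: "finite (A k)" "real (card (A k)) \<le> exp (L k)"
    "measure (nstep P t v0) (- A k) \<le> \<delta> k" for k by metis
  have terms: "\<delta> k * (L (Suc k) + real (k + 2) * ln 2)
      = 2 * ((b / 2) ^ k * (real (k + 4) * ln 2)) + 2 * b * G * (b\<^sup>2 / 2) ^ k" for k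
  proof -
    have "ln (4::real) = 2 * ln 2" using ln_realpow[of 2 2] by simp
    moreover have "(b / 2) ^ k * b ^ k = (b\<^sup>2 / 2) ^ k"
      by (simp add: power2_eq_square flip: power_mult_distrib)
    ultimately show ?thesis
      by (simp add: \<delta>_def L_def algebra_simps)
  qed
  have sum1: "summable (\<lambda>k. 2 * ((b / 2) ^ k * (real (k + 4) * ln 2)))"
  proof -
    have "(\<lambda>k. real (Suc k) * (b / 2) ^ k) sums (1 / (1 - b / 2)\<^sup>2)"
      using \<open>b < 2\<close> b by (intro geometric_deriv_sums) simp
    moreover have "summable (\<lambda>k. (b / 2) ^ k)" using \<open>b < 2\<close> b by (intro summable_geometric) simp
    ultimately have "summable (\<lambda>k. 2 * ln 2 * (real (Suc k) * (b / 2) ^ k) + 6 * ln 2 * (b / 2) ^ k)"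
      by (intro summable_add summable_mult) (auto simp: sums_iff)
    then show ?thesis by (simp add: algebra_simps)
  qed
  have sum2: "(\<lambda>k. 2 * b * G * (b\<^sup>2 / 2) ^ k) sums (2 * b * G * (1 / (1 - b\<^sup>2 / 2)))"
    using b by (intro sums_mult geometric_sums) simp
  have total: "(\<Sum>k. \<delta> k * (L (Suc k) + real (k + 2) * ln 2)) = S + 2 * b / (1 - b\<^sup>2 / 2) * G"
    unfolding terms using sum1 sum2 by (simp add: S_def sums_iff suminf_add[symmetric])
  have "entropy_pmf (nstep P t v0) \<le> ennreal (L 0 + ln 2 + (S + 2 * b / (1 - b\<^sup>2 / 2) * G) + 1)"
    unfolding total[symmetric]
  proof (rule entropy_pmf_le_multiscale[OF A(1,2) _ A(3)])
    show "L k \<ge> 0" for k using b \<open>G > 0\<close> by (simp add: L_def)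
    show "\<delta> \<longlonglongrightarrow> 0"
      unfolding \<delta>_def using \<open>b < 2\<close> b by (intro tendsto_mult_right_zero LIMSEQ_power_zero) simp
    show "summable (\<lambda>k. \<delta> k * (L (Suc k) + real (k + 2) * ln 2))"
      unfolding terms using sum1 sum2 by (intro summable_add) (auto simp: sums_iff)
  qed
  also have "\<dots> \<le> ennreal ((4 + S + 2 * b / (1 - b\<^sup>2 / 2)) * (G + 1))"
  proof (rule ennreal_leI)
    define W where "W = 2 * b / (1 - b\<^sup>2 / 2)"
    have "S \<ge> 0" unfolding S_def using b by (intro suminf_nonneg sum1) auto
    then have "S * G \<ge> 0" using \<open>G > 0\<close> by simp
    moreover have "W \<ge> 0" using b by (simp add: W_def)
    moreover have "ln (4::real) = 2 * ln 2" using ln_realpow[of 2 2] by simp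
    moreover have "ln (2::real) \<le> 1" using ln_le_minus_one[of "2::real"] by simp
    ultimately have "ln 4 + G + ln 2 + (S + W * G) + 1 \<le> 4 + S + W + (4 * G + S * G + W * G)"
      using \<open>G > 0\<close> by linarith
    then show "L 0 + ln 2 + (S + 2 * b / (1 - b\<^sup>2 / 2) * G) + 1 \<le> (4 + S + 2 * b / (1 - b\<^sup>2 / 2)) * (G + 1)"
      unfolding W_def[symmetric] by (simp add: L_def algebra_simps)
  qed
  finally show ?thesis by (simp add: S_def G_def entropy_bound_const_def)
qed

end

section \<open>The entropy bound in terms of the inverse function\<close>

lemma unbounded_positive_exceeds:
  assumes "unbounded_positive \<gamma>"
  shows "\<exists>z\<ge>1. \<gamma> z > v"
proof (rule ccontr)
  assume "\<not> (\<exists>z\<ge>1. \<gamma> z > v)"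
  then have "\<And>z. z \<ge> 1 \<Longrightarrow> norm (\<gamma> z) \<le> v"
    using assms by (force simp: unbounded_positive_def not_less)
  then have "bounded (\<gamma> ` {1..})" by (intro boundedI[of _ v]) auto
  then show False using assms by (simp add: unbounded_positive_def)
qed

lemma regular_growth_le:
  fixes \<gamma> :: "real \<Rightarrow> real"
  assumes pos: "\<And>t. t \<ge> 1 \<Longrightarrow> \<gamma> t > 0" and reg: "mono_on {1..} (\<lambda>t. t powr \<beta> / \<gamma> t)"
    and "1 \<le> y" "y \<le> z"
  shows "\<gamma> z \<le> (z / y) powr \<beta> * \<gamma> y"
proof -
  have "y powr \<beta> / \<gamma> y \<le> z powr \<beta> / \<gamma> z"
    using \<open>1 \<le> y\<close> \<open>y \<le> z\<close> order_trans[of 1 y z] by (intro mono_onD[OF reg]) auto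
  then show ?thesis
    using assms pos[of y] pos[of z] by (simp add: powr_divide field_simps)
qed

text \<open>The two monotonicity hypotheses squeeze \<open>\<gamma>(z)\<close> between \<open>\<gamma>(x)\<close> and
  \<open>(z/x)\<^sup>\<beta> \<gamma>(x)\<close>, so \<open>\<gamma>\<close> is continuous and the intermediate value theorem
  applies. This makes every value of \<open>inv_into\<close> occurring in \<open>rho\<close> a genuine preimage.\<close>
lemma surj_on_atLeast_of_regular_growth:
  fixes \<gamma> :: "real \<Rightarrow> real"
  assumes unb: "unbounded_positive \<gamma>" and mono: "mono_on {1..} \<gamma>"
    and reg: "mono_on {1..} (\<lambda>t. t powr \<beta> / \<gamma> t)" and v: "v \<ge> \<gamma> 1"
  shows "\<exists>y\<ge>1. \<gamma> y = v"
proof -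
  have pos: "\<gamma> t > 0" if "t \<ge> 1" for t using unb that by (simp add: unbounded_positive_def)
  have "continuous_on {1..} \<gamma>"
    unfolding continuous_on_def
  proof
    fix x :: real assume "x \<in> {1..}"
    then have x: "x \<ge> 1" by simp
    have bound: "\<bar>\<gamma> z - \<gamma> x\<bar> \<le> \<gamma> x * \<bar>(z / x) powr \<beta> - 1\<bar>" if "z \<ge> 1" for z
    proof (cases "x \<le> z")
      case True
      then have "\<gamma> x \<le> \<gamma> z" using x by (intro mono_onD[OF mono]) auto
      moreover have "\<gamma> z - \<gamma> x \<le> \<gamma> x * ((z / x) powr \<beta> - 1)"
        using regular_growth_le[OF pos reg x True] by (simp add: algebra_simps)
      moreover have "\<gamma> x * ((z / x) powr \<beta> - 1) \<le> \<gamma> x * \<bar>(z / x) powr \<beta> - 1\<bar>"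
        using pos[OF x] by (intro mult_left_mono) auto
      ultimately show ?thesis by linarith
    next
      case False
      then have "\<gamma> z \<le> \<gamma> x" using that by (intro mono_onD[OF mono]) auto
      moreover have "(z / x) powr \<beta> * \<gamma> x \<le> \<gamma> z"
      proof -
        have "\<gamma> x \<le> (x / z) powr \<beta> * \<gamma> z" using regular_growth_le[OF pos reg that] False by simp
        then have "(z / x) powr \<beta> * \<gamma> x \<le> (z / x) powr \<beta> * ((x / z) powr \<beta> * \<gamma> z)"
          by (intro mult_left_mono) auto
        also have "\<dots> = ((z / x) * (x / z)) powr \<beta> * \<gamma> z"
          using x that by (subst powr_mult) auto
        also have "\<dots> = \<gamma> z" using x that by simp
        finally show ?thesis .
      qed
      then have "\<gamma> x - \<gamma> z \<le> \<gamma> x * (1 - (z / x) powr \<beta>)" by (simp add: algebra_simps)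
      moreover have "\<gamma> x * (1 - (z / x) powr \<beta>) \<le> \<gamma> x * \<bar>(z / x) powr \<beta> - 1\<bar>"
        using pos[OF x] by (intro mult_left_mono) auto
      ultimately show ?thesis by linarith
    qed
    have "((\<lambda>z. \<gamma> x * \<bar>(z / x) powr \<beta> - 1\<bar>) \<longlongrightarrow> \<gamma> x * \<bar>(x / x) powr \<beta> - 1\<bar>) (at x within {1..})"
      using x by (intro tendsto_intros) auto
    then have lim: "((\<lambda>z. \<gamma> x * \<bar>(z / x) powr \<beta> - 1\<bar>) \<longlongrightarrow> 0) (at x within {1..})" using x by simp
    have "((\<lambda>z. \<gamma> z - \<gamma> x) \<longlongrightarrow> 0) (at x within {1..})"
      by (rule Lim_null_comparison[OF _ lim]) (auto simp: eventually_at_filter bound)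
    then show "(\<gamma> \<longlongrightarrow> \<gamma> x) (at x within {1..})" by (simp add: LIM_zero_iff)
  qed
  moreover obtain z where z: "z \<ge> 1" "\<gamma> z > v" using unbounded_positive_exceeds[OF unb] by blast
  ultimately have "\<exists>y\<ge>1. y \<le> z \<and> \<gamma> y = v"
    using v by (intro IVT') (auto intro: continuous_on_subset)
  then show ?thesis by blast
qed

text \<open>Every \<open>x\<close> in the set defining \<open>\<rho>(t)\<close> is \<open>2 \<gamma>(y)\<close> for some \<open>y > t x\<close>, and rounding
  \<open>y\<close> up to an integer \<open>m\<close> gives \<open>\<gamma>(m) \<le> x\<close> and \<open>t \<gamma>(m) \<le> m\<close>. So
  \<open>C (x + 1)\<close> bounds the entropy for each such \<open>x\<close>, hence also for their infimum.\<close>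
lemma entropy_const_bound:
  assumes \<beta>: "0 < \<beta>" "\<beta> < 1/2"
  shows "entropy_const TYPE('v) \<beta> (max 1 (entropy_bound_const (2 powr \<beta>)))"
  unfolding entropy_const_def
proof (intro allI impI, elim conjE)
  fix E :: "'v \<Rightarrow> 'v \<Rightarrow> bool" and \<Gamma> v0 P \<gamma> and t :: nat
  assume walk: "homogeneous_walk E \<Gamma> v0 P" and unb: "unbounded_positive \<gamma>"
    and strict: "strict_mono_on {1..} \<gamma>" and reg: "mono_on {1..} (\<lambda>t. t powr \<beta> / \<gamma> t)"
    and low: "return_lower_bound P v0 \<gamma>" and t: "1 \<le> t"
  interpret homogeneous_walk E \<Gamma> v0 P by (rule walk)
  define b where "b = 2 powr \<beta>"
  define C where "C = max 1 (entropy_bound_const b)"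
  have pos: "\<gamma> t > 0" if "t \<ge> 1" for t using unb that by (simp add: unbounded_positive_def)
  have mono: "mono_on {1..} \<gamma>" using strict by (rule strict_mono_on_imp_mono_on)
  have inv: "inv_into {1..} \<gamma> (\<gamma> y) = y" if "y \<ge> 1" for y
    using that strict_mono_on_imp_inj_on[OF strict] by simp
  have b: "b \<ge> 1" "b\<^sup>2 < 2"
  proof -
    show "b \<ge> 1" using \<beta> by (simp add: b_def ge_one_powr_ge_zero)
    have "b\<^sup>2 = 2 powr (2 * \<beta>)" by (simp add: b_def power2_eq_square flip: powr_add)
    also have "\<dots> < 2 powr 1" using \<beta> by (intro powr_less_mono) auto
    finally show "b\<^sup>2 < 2" by simp
  qed
  have doubling: "\<gamma> (2 * s) \<le> b * \<gamma> s" if "s \<ge> 1" for s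
    using regular_growth_le[OF pos reg that, of "2 * s"] that by (simp add: b_def)
  define X where "X = {x. x \<ge> 2 * \<gamma> 1 \<and> inv_into {1..} \<gamma> (x / 2) / x > real t}"
  have bound: "entropy_pmf (nstep P t v0) \<le> ennreal (C * (x + 1))" if "x \<in> X" for x
  proof -
    have x: "x \<ge> 2 * \<gamma> 1" "inv_into {1..} \<gamma> (x / 2) / x > real t" using that by (auto simp: X_def)
    then have "x > 0" using pos[of 1] by linarith
    obtain y where y: "y \<ge> 1" "\<gamma> y = x / 2"
      using surj_on_atLeast_of_regular_growth[OF unb mono reg, of "x / 2"] x by auto
    then have "inv_into {1..} \<gamma> (x / 2) = y" using inv[of y] by (simp flip: y(2))
    then have ty: "real t * x < y" using x \<open>x > 0\<close> by (simp add: pos_less_divide_eq)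
    define m where "m = nat \<lceil>y\<rceil>"
    have m: "y \<le> real m" "real m \<le> 2 * y" "m \<ge> 1" using y(1) unfolding m_def by linarith+
    have "\<gamma> m \<le> \<gamma> (2 * y)" using m y by (intro mono_onD[OF mono]) auto
    also have "\<dots> \<le> b * \<gamma> y" by (rule doubling[OF y(1)])
    also have "\<dots> \<le> 2 * \<gamma> y"
      using b pos[OF y(1)] power_mono[of 2 b 2] by (intro mult_right_mono) (cases "b \<le> 2"; auto)+
    also have "\<dots> = x" using y by simp
    finally have gm: "\<gamma> m \<le> x" .
    have "real t * \<gamma> m \<le> real t * x" using gm by (intro mult_left_mono) auto
    then have small: "real t * \<gamma> m \<le> real m" using ty m by linarith
    have "entropy_pmf (nstep P t v0) \<le> ennreal (entropy_bound_const b * (\<gamma> m + 1))"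
      by (rule entropy_le_of_polynomial_return_bound[OF low pos b doubling m(3) t small])
    also have "\<dots> \<le> ennreal (C * (x + 1))"
      using gm pos[of "real m"] m unfolding C_def
      by (intro ennreal_leI mult_mono) (auto simp: less_imp_le)
    finally show ?thesis .
  qed
  \<comment> \<open>the infimum of the empty set would be an unspecified real number; here \<open>\<gamma>(y)\<close> grows
    at most like \<open>y\<^sup>\<beta>\<close>, so \<open>y / (2 \<gamma>(y))\<close> is unbounded\<close>
  have "X \<noteq> {}"
  proof -
    have "filterlim (\<lambda>y::real. y / (2 * y powr \<beta> * \<gamma> 1)) at_top at_top"
      using \<beta> pos[of 1] by real_asymp
    then have "\<forall>\<^sub>F y::real in at_top. y / (2 * y powr \<beta> * \<gamma> 1) > real t \<and> y \<ge> 1"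
      by (simp add: filterlim_at_top_dense eventually_conj_iff eventually_ge_at_top)
    then obtain y where y: "y / (2 * y powr \<beta> * \<gamma> 1) > real t" "y \<ge> 1"
      using eventually_happens[of _ at_top] by (metis (no_types, lifting) trivial_limit_at_top_linorder)
    have "\<gamma> y \<le> y powr \<beta> * \<gamma> 1" using regular_growth_le[OF pos reg _ y(2)] by simp
    then have "y / (2 * y powr \<beta> * \<gamma> 1) \<le> y / (2 * \<gamma> y)"
      using y pos[OF y(2)] pos[of 1] by (intro divide_left_mono) auto
    moreover have "\<gamma> 1 \<le> \<gamma> y" using y by (intro mono_onD[OF mono]) auto
    ultimately have "2 * \<gamma> y \<in> X" using y inv[OF y(2)] by (auto simp: X_def)
    then show ?thesis by blast
  qed
  then obtain x0 where x0: "x0 \<in> X" by blast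
  have "C \<ge> 1" by (simp add: C_def)
  have "entropy_pmf (nstep P t v0) \<le> ennreal (C * (Inf X + 1))"
  proof (cases "entropy_pmf (nstep P t v0)")
    case (real r)
    have "r / C - 1 \<le> x" if "x \<in> X" for x
    proof -
      have "x \<ge> 0" using that pos[of 1] by (auto simp: X_def)
      then have "r \<le> C * (x + 1)"
        using bound[OF that] real \<open>C \<ge> 1\<close> by (subst (asm) real(2)) (simp add: ennreal_le_iff)
      then show ?thesis using \<open>C \<ge> 1\<close> by (simp add: field_simps)
    qed
    then have "r / C - 1 \<le> Inf X" using \<open>X \<noteq> {}\<close> by (intro cInf_greatest)
    then have "r \<le> C * (Inf X + 1)" using \<open>C \<ge> 1\<close> by (simp add: field_simps)
    then show ?thesis using real by (simp add: ennreal_leI)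
  next
    case top
    then show ?thesis using bound[OF x0] by (simp add: top_unique)
  qed
  then show "entropy_step P v0 t \<le> ennreal (max 1 (entropy_bound_const (2 powr \<beta>)) * (rho \<gamma> (real t) + 1))"
    by (simp add: entropy_step_eq C_def b_def rho_def X_def)
qed

section \<open>Relabelling the vertices\<close>

lemma group_Aut_group: "group (Aut_group E)"
proof (rule groupI)
  fix g assume g: "g \<in> carrier (Aut_group E)"
  let ?h = "inv_into UNIV g"
  from g have "bij g" by (simp add: Aut_group_def graph_auts_def)
  then have inv: "?h \<circ> g = id" "bij ?h" "\<And>x. g (?h x) = x"
    by (simp_all add: bij_is_inj bij_imp_bij_inv bij_is_surj surj_f_inv_f)
  have "E (?h x) (?h y) \<longleftrightarrow> E (g (?h x)) (g (?h y))" for x y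
    using g by (simp add: Aut_group_def graph_auts_def)
  then show "\<exists>h\<in>carrier (Aut_group E). h \<otimes>\<^bsub>Aut_group E\<^esub> g = \<one>\<^bsub>Aut_group E\<^esub>"
    using inv by (intro bexI[of _ ?h]) (simp_all add: Aut_group_def graph_auts_def)
qed (auto simp: Aut_group_def graph_auts_def bij_comp comp_assoc)

text \<open>A homogeneous walk together with a bijection \<open>f\<close>, given with its inverse, onto another
  type; all structure is carried over by conjugation.\<close>
locale relabelled_walk = homogeneous_walk E \<Gamma> v0 P
  for E :: "'v \<Rightarrow> 'v \<Rightarrow> bool" and \<Gamma> v0 P +
  fixes f :: "'v \<Rightarrow> 'w" and f' :: "'w \<Rightarrow> 'v"
  assumes f'_f [simp]: "f' (f x) = x" and f_f' [simp]: "f (f' a) = a"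
begin

definition E' where "E' a b \<longleftrightarrow> E (f' a) (f' b)"
definition P' where "P' a = map_pmf f (P (f' a))"
definition conjugate where "conjugate g = (\<lambda>a. f (g (f' a)))"

lemma inj_f: "inj f" and bij_f: "bij f"
  by (metis f'_f injI) (metis f'_f f_f' o_bij comp_apply ext id_apply)

lemma nstep_P': "nstep P' n (f x) = map_pmf f (nstep P n x)"
  by (induction n arbitrary: x) (simp_all add: P'_def bind_map_pmf map_bind_pmf)

lemma pmf_nstep_P': "pmf (nstep P' n (f x)) (f y) = pmf (nstep P n x) y"
  by (simp add: nstep_P' pmf_map_inj' inj_f)

lemma entropy_step_P': "entropy_step P' (f v0) n = entropy_step P v0 n"
  unfolding entropy_step_def
  by (subst infsum_reindex_bij_betw[OF bij_f, symmetric]) (simp add: pmf_nstep_P')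

lemma graph_auts_relabel: "conjugate g \<in> graph_auts E' \<longleftrightarrow> g \<in> graph_auts E"
proof -
  have "bij (conjugate g) \<longleftrightarrow> bij g"
  proof -
    have "bij f'" by (metis f'_f f_f' o_bij comp_apply ext id_apply)
    moreover have "conjugate g = f \<circ> g \<circ> f'" "g = f' \<circ> conjugate g \<circ> f" by (auto simp: conjugate_def)
    ultimately show ?thesis using bij_f by (metis bij_comp)
  qed
  moreover have "(\<forall>a b. E' (conjugate g a) (conjugate g b) \<longleftrightarrow> E' a b) \<longleftrightarrow> (\<forall>x y. E (g x) (g y) \<longleftrightarrow> E x y)"
    unfolding E'_def conjugate_def by simp (metis f'_f)
  ultimately show ?thesis by (simp add: graph_auts_def)
qed

lemma acts_transitively_relabel:
  assumes "acts_transitively G"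
  shows "acts_transitively (conjugate ` G)"
  unfolding acts_transitively_def
proof (intro allI)
  fix a b
  obtain g where "g \<in> G" "g (f' a) = f' b" using assms by (auto simp: acts_transitively_def)
  then show "\<exists>h\<in>conjugate ` G. h a = b" by (auto simp: conjugate_def intro!: bexI[of _ g])
qed

lemma subgroup_relabel: "subgroup (conjugate ` \<Gamma>) (Aut_group E')"
proof -
  have "conjugate \<in> hom (Aut_group E) (Aut_group E')"
    by (rule homI) (auto simp: Aut_group_def graph_auts_relabel, auto simp: conjugate_def)
  then have "group_hom (Aut_group E) (Aut_group E') conjugate"
    by (simp add: group_hom_def group_hom_axioms_def group_Aut_group)
  then show ?thesis using subgroup_Aut by (rule group_hom.subgroup_img_is_subgroup)
qed

text \<open>Conjugating back is continuous for pointwise convergence, because each of its coordinates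
  depends on a single value of the argument; the relabelled group is the preimage of
  \<open>\<Gamma>\<close> under it.\<close>
lemma closed_relabel: "closedin (Aut_topology E') (conjugate ` \<Gamma>)"
proof -
  define unconj where "unconj h = (\<lambda>x. f' (h (f x)))" for h
  have unconj: "conjugate (unconj h) = h" "unconj (conjugate g) = g" for h g
    by (auto simp: conjugate_def unconj_def)
  have top: "topspace (Aut_topology D) = graph_auts D" for D :: "'a \<Rightarrow> 'a \<Rightarrow> bool"
    by (simp add: Aut_topology_def)
  have \<Gamma>: "\<Gamma> \<subseteq> graph_auts E" using closedin_subset[OF closed_Aut] by (simp add: top)
  have "continuous_map (Aut_topology E') (Aut_topology E) unconj"
    unfolding Aut_topology_def
  proof (rule continuous_map_into_subtopology)
    show "continuous_map (subtopology (product_topology (\<lambda>_. discrete_topology UNIV) UNIV) (graph_auts E'))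
        (product_topology (\<lambda>_. discrete_topology UNIV) UNIV) unconj"
      unfolding continuous_map_componentwise_UNIV
    proof (intro allI continuous_map_from_subtopology)
      fix x
      have "continuous_map (product_topology (\<lambda>_. discrete_topology UNIV) UNIV) (discrete_topology UNIV)
          (f' \<circ> (\<lambda>h. h (f x)))"
        by (rule continuous_map_compose[OF continuous_map_product_projection]) auto
      then show "continuous_map (product_topology (\<lambda>_. discrete_topology UNIV) UNIV) (discrete_topology UNIV)
          (\<lambda>h. unconj h x)"
        by (simp add: unconj_def comp_def)
    qed
    show "unconj \<in> topspace (subtopology (product_topology (\<lambda>_. discrete_topology UNIV) UNIV) (graph_auts E'))
        \<rightarrow> graph_auts E"
      using graph_auts_relabel[of "unconj _"] by (auto simp: unconj)
  qed
  from closedin_continuous_map_preimage[OF this closed_Aut]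
  have "closedin (Aut_topology E') {h \<in> graph_auts E'. unconj h \<in> \<Gamma>}" by (simp add: top)
  moreover have "{h \<in> graph_auts E'. unconj h \<in> \<Gamma>} = conjugate ` \<Gamma>"
  proof (intro equalityI subsetI)
    fix h assume "h \<in> {h \<in> graph_auts E'. unconj h \<in> \<Gamma>}"
    then show "h \<in> conjugate ` \<Gamma>" by (intro image_eqI[of _ _ "unconj h"]) (simp_all add: unconj)
  next
    fix h assume "h \<in> conjugate ` \<Gamma>"
    then show "h \<in> {h \<in> graph_auts E'. unconj h \<in> \<Gamma>}"
      using \<Gamma> by (auto simp: unconj graph_auts_relabel)
  qed
  ultimately show ?thesis by simp
qed

lemma infinite_transitive_graph_relabel: "infinite_transitive_graph E'"
proof
  show "symp E'" using edges_sym by (auto simp: E'_def symp_def)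
  show "irreflp E'" using edges_irrefl by (auto simp: E'_def irreflp_def)
  show "finite {b. E' a b}" for a
  proof -
    have "{b. E' a b} = f ` {y. E (f' a) y}" by (force simp: E'_def image_iff)
    then show ?thesis using locally_finite by simp
  qed
  show "infinite (UNIV :: 'w set)"
    using infinite_vertices finite_imageI[of UNIV f'] by (metis f'_f surjI)
  have "E'\<^sup>*\<^sup>* (f x) (f y)" if "E\<^sup>*\<^sup>* x y" for x y
    using that by induction (auto simp: E'_def intro: rtranclp.rtrancl_into_rtrancl)
  then show "E'\<^sup>*\<^sup>* a b" for a b
    using connected_graph[of "f' a" "f' b"] by fastforce
  have "graph_auts E' \<supseteq> conjugate ` graph_auts E" by (auto simp: graph_auts_relabel)
  then show "acts_transitively (graph_auts E')"
    using acts_transitively_relabel[OF vertex_transitive] unfolding acts_transitively_def by blast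
qed

lemma homogeneous_walk_relabel: "homogeneous_walk E' (conjugate ` \<Gamma>) (f v0) P'"
proof (intro homogeneous_walk.intro homogeneous_walk_axioms.intro infinite_transitive_graph_relabel)
  show "subgroup (conjugate ` \<Gamma>) (Aut_group E')" by (rule subgroup_relabel)
  show "closedin (Aut_topology E') (conjugate ` \<Gamma>)" by (rule closed_relabel)
  show "acts_transitively (conjugate ` \<Gamma>)" by (rule acts_transitively_relabel[OF transitive_\<Gamma>])
  have pmf_P': "pmf (P' a) b = pmf (P (f' a)) (f' b)" for a b
    using pmf_map_inj'[OF inj_f, of "P (f' a)" "f' b"] by (simp add: P'_def)
  show "\<exists>n. 0 < pmf (nstep P' n a) b" for a b
    using irreducible[of "f' a" "f' b"] pmf_nstep_P'[of _ "f' a" "f' b"] by simp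
  show "pmf (P' (h a)) (h b) = pmf (P' a) b" if "h \<in> conjugate ` \<Gamma>" for h a b
    using that space_homogeneous by (auto simp: pmf_P' conjugate_def)
  show "pmf (P' a) b = pmf (P' b) a" for a b
    by (simp add: pmf_P' symmetric)
  show "entropy_step P' (f v0) 1 < \<infinity>"
    unfolding entropy_step_P' by (rule finite_entropy)
qed

end

text \<open>Irreducibility makes the vertex set countable: it is the union over \<open>n\<close> of the supports of
  the \<open>n\<close>-step laws. Being infinite, it can be enumerated by the natural numbers, and neither
  the return probabilities nor the entropies change.\<close>
lemma entropy_const_relabel:
  assumes "entropy_const TYPE(nat) \<beta> C"
  shows "entropy_const TYPE('v) \<beta> C"
  unfolding entropy_const_def
proof (intro allI impI, elim conjE)
  fix E :: "'v \<Rightarrow> 'v \<Rightarrow> bool" and \<Gamma> v0 P \<gamma> and n :: nat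
  assume walk: "homogeneous_walk E \<Gamma> v0 P" and \<gamma>: "unbounded_positive \<gamma>"
    "strict_mono_on {1..} \<gamma>" "mono_on {1..} (\<lambda>t. t powr \<beta> / \<gamma> t)"
    and low: "return_lower_bound P v0 \<gamma>" and n: "1 \<le> n"
  interpret homogeneous_walk E \<Gamma> v0 P by (rule walk)
  interpret relabelled_walk E \<Gamma> v0 P "to_nat_on UNIV" "from_nat_into UNIV"
    by unfold_locales (use countable_vertices infinite_vertices in \<open>auto intro: to_nat_on_from_nat_into_infinite\<close>)
  have "return_lower_bound P' (to_nat_on UNIV v0) \<gamma>"
    using low by (simp add: return_lower_bound_def pmf_nstep_P')
  then show "entropy_step P v0 n \<le> ennreal (C * (rho \<gamma> (real n) + 1))"
    using assms homogeneous_walk_relabel \<gamma> n entropy_step_P'[of n]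
    unfolding entropy_const_def by metis
qed

theorem theorem6p1:
  "(\<forall>(E :: 'v \<Rightarrow> 'v \<Rightarrow> bool) \<Gamma> v0 P \<gamma>.
      homogeneous_walk E \<Gamma> v0 P \<and>
      unbounded_positive \<gamma> \<and> mono_on {1..} \<gamma> \<and>
      mono_on {1..} (\<lambda>t. t powr (1/2) / \<gamma> t) \<and>
      ((\<lambda>t. \<gamma> t / t powr (1/2)) \<longlongrightarrow> 0) at_top \<and>
      return_lower_bound P v0 \<gamma>
      \<longrightarrow> liouville P) \<and>
   (\<forall>\<beta>. 0 < \<beta> \<and> \<beta> < 1/2 \<longrightarrow>
      (\<exists>C. entropy_const TYPE(nat) \<beta> C) \<and>
      (\<forall>C. entropy_const TYPE(nat) \<beta> C \<longrightarrow> entropy_const TYPE('v) \<beta> C))"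
proof (intro conjI allI impI)
  fix E :: "'v \<Rightarrow> 'v \<Rightarrow> bool" and \<Gamma> v0 P \<gamma>
  assume *: "homogeneous_walk E \<Gamma> v0 P \<and> unbounded_positive \<gamma> \<and> mono_on {1..} \<gamma> \<and>
      mono_on {1..} (\<lambda>t. t powr (1/2) / \<gamma> t) \<and>
      ((\<lambda>t. \<gamma> t / t powr (1/2)) \<longlongrightarrow> 0) at_top \<and> return_lower_bound P v0 \<gamma>"
  then interpret homogeneous_walk E \<Gamma> v0 P by blast
  show "liouville P"
    using * by (intro liouville_of_sublinear_entropy entropy_sublinear[of \<gamma>])
      (auto simp: unbounded_positive_def)
next
  fix \<beta> :: real
  assume "0 < \<beta> \<and> \<beta> < 1/2"
  then show "\<exists>C. entropy_const TYPE(nat) \<beta> C" using entropy_const_bound by blast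
next
  fix \<beta> C :: real
  assume "entropy_const TYPE(nat) \<beta> C"
  then show "entropy_const TYPE('v) \<beta> C" by (rule entropy_const_relabel)
qed

end
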